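(* Let $n\ge3$, let $G^\star=([n],E^\star)$ be a directed graph (directed cycles allowed), let $(\mathcal P,\pi)\in S_6$, and let $G=([n],E)$ be a directed graph satisfying: (1) for all $(a,b)\in[n]^2$, $a$ and $b$ are $p$-adjacent in $G$ iff $(a,b)\in E^{(1)}_{(\mathcal P,\pi)}$; (2) for all $(a,b)\in[n]^2$, $a$ is an ancestor of $b$ in $G$ iff $C_{a,\mathcal P}\le_\pi C_{b,\mathcal P}$; (3) if $(a,b,c)\in E^{(3)}_{(\mathcal P,\pi)}$ and $(a,b',c)\notin E^{(3)}_{(\mathcal P,\pi)}$ for every $b'\in[n]$ with $C_{b',\mathcal P}\le_\pi C_{b,\mathcal P}$ and $C_{b',\mathcal P}\ne C_{b,\mathcal P}$, then $a$ and $c$ have a common child in $C_{b,\mathcal P}$ in $G$; (4) if $(a,b),(c,b)\in E^{(1)}_{(\mathcal P,\pi)}$, $(a,c)\notin E^{(1)}_{(\mathcal P,\pi)}$, $C_{b,\mathcal P}\not\le_\pi\max\{C_{a,\mathcal P},C_{c,\mathcal P}\}$ and $(a,b,c)\notin E^{(3)}_{(\mathcal P,\pi)}$, then $a$ and $c$ do not have a common child in $C_{b,\mathcal P}$ in $G$. Then $G$ is Markov equivalent to $G^\star$. Moreover, $G^\star$ itself satisfies properties (1)–(4) with respect to the partially ordered partition associated with $G^\star$.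
   Context: $[n]=\{1,\dots,n\}$. The observed distribution is Markov and faithful to $G^\star$; for distinct $a,b$ and $Z\subseteq[n]\setminus\{a,b\}$, $a\perp\!\!\!\perp b\mid Z$ means $a$ and $b$ are $d$-separated given $Z$ in $G^\star$, and $a\not\perp\!\!\!\perp b\mid Z$ is its negation. Two directed graphs on $[n]$ are Markov equivalent if they satisfy the same $d$-separation statements. In a directed graph, $a$ is an ancestor of $b$ if $a=b$ or there is a directed path from $a$ to $b$. Distinct $a,b$ are $p$-adjacent in a directed graph $G$ if there is an edge between them (either direction), or they have a common child which is an ancestor of $a$ or of $b$. $\mathcal S$ is the set of pairs $(\mathcal P,\pi)$ with $\mathcal P$ a partition of $[n]$ and $\pi$ a partial order on $\mathcal P$; $C_1\le_\pi C_2$ iff $(C_1,C_2)\in\pi$; $C_{i,\mathcal P}$ is the block containing $i$; $C\le_\pi\max\{C_1,\dots,C_t\}$ means $C\le_\pi C_i$ for some $i$. The strongly connected components of a directed graph $G$ are the classes of $i\sim j$ iff $i=j$ or there are directed paths $i\to j$ and $j\to i$; on them $C_1\le_G C_2$ iff $C_1=C_2$ or there is a directed path from a vertex of $C_1$ to a vertex of $C_2$. The partially ordered partition associated with $G$ is (its set of strongly connected components, $\le_G$). For $(\mathcal P,\pi)\in\mathcal S$ (all sets indexed by $(\mathcal P,\pi)$): $E^{(1)}=\{(a,b): a\ne b,\ a\not\perp\!\!\!\perp b\mid\bigcup\{C\in\mathcal P: C\le_\pi\max\{C_{a,\mathcal P},C_{b,\mathcal P}\}\}\setminus\{a,b\}\}$;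 $E^{(2)}$: $(a,b,c)$ distinct, $(a,b),(c,b)\in E^{(1)}$, $(a,c)\notin E^{(1)}$, $C_{b,\mathcal P}\le_\pi\max\{C_{a,\mathcal P},C_{c,\mathcal P}\}$; $E^{(3)}$: $(a,b,c)$ distinct, $(a,b),(c,b)\in E^{(1)}$, $(a,c)\notin E^{(1)}$, $a\not\perp\!\!\!\perp c\mid\bigcup\{C\in\mathcal P: C\le_\pi\max\{C_{a,\mathcal P},C_{b,\mathcal P},C_{c,\mathcal P}\}\}\setminus\{a,c\}$; $E^{(4)}$: pairs $((a,b_1,c),(a,b_2,c))$ with $a,b_1,c$ distinct, $a,b_2,c$ distinct, $(a,b_1),(c,b_1),(a,b_2),(c,b_2)\in E^{(1)}$, $(a,c)\notin E^{(1)}$, $(a,b_1,c),(a,b_2,c)\notin E^{(2)}\cup E^{(3)}$, $C_{b_1,\mathcal P}\le_\pi C_{b_2,\mathcal P}$; for $t\in\{1,\dots,n-2\}$, $D^{(t)}$: $(a_0,\dots,a_{t+1})$ distinct with $(a_i,a_{i+1})\in E^{(1)}$ for $i\in\{0,\dots,t\}$, $(a_i,a_j)\notin E^{(1)}$ for $i\in\{2,\dots,t+1\}$, $j\in\{0,\dots,i-2\}$, $C_{a_1,\mathcal P}=\dots=C_{a_t,\mathcal P}$, not $C_{a_1,\mathcal P}\le_\pi\max\{C_{a_0,\mathcal P},C_{a_{t+1},\mathcal P}\}$; $E^{(6)}=\bigcup_{t=1}^{n-2}\{((a_0,\dots,a_{t+1}),(a_0,b,a_{t+1})): a_0,b,a_{t+1}$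 distinct, $(a_0,b),(a_{t+1},b)\in E^{(1)}$, $(a_0,b,a_{t+1})\notin E^{(2)}\cup E^{(3)}$, $(a_0,\dots,a_{t+1})\in D^{(t)}$, $C_{a_1,\mathcal P}\le_\pi C_{b,\mathcal P}\}$. $S_1=\operatorname{argmin}_{\mathcal S}|E^{(1)}|$, $S_2=\operatorname{argmin}_{S_1}|E^{(2)}|$, $S_3=\operatorname{argmin}_{S_2}|E^{(3)}|$, $S_4=\operatorname{argmin}_{S_3}|E^{(4)}|$, $S_5^{(1)}=S_4$, $S_5^{(t)}=\operatorname{argmax}_{S_5^{(t-1)}}|D^{(t)}|$ for $t=2,\dots,n-2$, and $S_6=\operatorname{argmin}_{S_5^{(n-2)}}|E^{(6)}|$. *)

theory Defs
  imports Main
begin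

definition digraph :: "nat \<Rightarrow> (nat \<times> nat) set \<Rightarrow> bool" where
  "digraph n E \<longleftrightarrow> E \<subseteq> {1..n} \<times> {1..n} \<and> (\<forall>a. (a, a) \<notin> E)"

definition anc :: "(nat \<times> nat) set \<Rightarrow> nat \<Rightarrow> nat \<Rightarrow> bool" where
  "anc E a b \<longleftrightarrow> (a, b) \<in> E\<^sup>*"

text \<open>d-connection (for possibly cyclic graphs): there is a path, i.e. a sequence
vs of distinct vertices from a to b together with a choice of an edge between each
pair of consecutive vertices (ds!i = True: vs!i \<rightarrow> vs!(i+1), False: vs!(i+1) \<rightarrow> vs!i),
such that every collider on the path is an ancestor of a vertex of Z and every
non-collider interior vertex is outside Z.\<close>
definition dconn :: "(nat \<times> nat) set \<Rightarrow> nat \<Rightarrow> nat \<Rightarrow> nat set \<Rightarrow> bool" where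
  "dconn E a b Z \<longleftrightarrow> (\<exists>vs ds.
      length vs \<ge> 2 \<and> hd vs = a \<and> last vs = b \<and> distinct vs \<and>
      length ds = length vs - 1 \<and>
      (\<forall>i < length ds. if ds ! i then (vs ! i, vs ! Suc i) \<in> E else (vs ! Suc i, vs ! i) \<in> E) \<and>
      (\<forall>i. 0 < i \<and> i < length vs - 1 \<longrightarrow>
          (if ds ! (i - 1) \<and> \<not> ds ! i
           then (\<exists>z\<in>Z. anc E (vs ! i) z)
           else vs ! i \<notin> Z)))"

definition dsep :: "(nat \<times> nat) set \<Rightarrow> nat \<Rightarrow> nat \<Rightarrow> nat set \<Rightarrow> bool" where
  "dsep E a b Z \<longleftrightarrow> \<not> dconn E a b Z"

definition markov_equiv :: "nat \<Rightarrow> (nat \<times> nat) set \<Rightarrow> (nat \<times> nat) set \<Rightarrow> bool" where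
  "markov_equiv n E1 E2 \<longleftrightarrow>
     (\<forall>a\<in>{1..n}. \<forall>b\<in>{1..n}. \<forall>Z. a \<noteq> b \<and> Z \<subseteq> {1..n} - {a, b} \<longrightarrow>
        (dsep E1 a b Z \<longleftrightarrow> dsep E2 a b Z))"

definition padj :: "(nat \<times> nat) set \<Rightarrow> nat \<Rightarrow> nat \<Rightarrow> bool" where
  "padj E a b \<longleftrightarrow> a \<noteq> b \<and>
     ((a, b) \<in> E \<or> (b, a) \<in> E \<or>
      (\<exists>c. (a, c) \<in> E \<and> (b, c) \<in> E \<and> (anc E c a \<or> anc E c b)))"

definition is_partition :: "nat \<Rightarrow> nat set set \<Rightarrow> bool" where
  "is_partition n P \<longleftrightarrow> (\<Union>P = {1..n}) \<and> {} \<notin> P \<and>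
     (\<forall>C1\<in>P. \<forall>C2\<in>P. C1 \<noteq> C2 \<longrightarrow> C1 \<inter> C2 = {})"

definition is_porder_on :: "nat set set \<Rightarrow> (nat set \<times> nat set) set \<Rightarrow> bool" where
  "is_porder_on P \<pi> \<longleftrightarrow> \<pi> \<subseteq> P \<times> P \<and> (\<forall>C\<in>P. (C, C) \<in> \<pi>) \<and>
     (\<forall>C1 C2. (C1, C2) \<in> \<pi> \<and> (C2, C1) \<in> \<pi> \<longrightarrow> C1 = C2) \<and>
     (\<forall>C1 C2 C3. (C1, C2) \<in> \<pi> \<and> (C2, C3) \<in> \<pi> \<longrightarrow> (C1, C3) \<in> \<pi>)"

type_synonym popart = "nat set set \<times> (nat set \<times> nat set) set"

definition SS :: "nat \<Rightarrow> popart set" where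
  "SS n = {(P, \<pi>). is_partition n P \<and> is_porder_on P \<pi>}"

definition blk :: "nat set set \<Rightarrow> nat \<Rightarrow> nat set" where
  "blk P i = (THE C. C \<in> P \<and> i \<in> C)"

definition le_max :: "(nat set \<times> nat set) set \<Rightarrow> nat set \<Rightarrow> nat set set \<Rightarrow> bool" where
  "le_max \<pi> C Cs \<longleftrightarrow> (\<exists>C'\<in>Cs. (C, C') \<in> \<pi>)"

definition down :: "nat set set \<Rightarrow> (nat set \<times> nat set) set \<Rightarrow> nat set set \<Rightarrow> nat set" where
  "down P \<pi> Cs = \<Union>{C \<in> P. le_max \<pi> C Cs}"

section \<open>The sets E1, E2, E3, E4, D(t), E6 (independence = d-separation in G*)\<close>

definition E1 :: "nat \<Rightarrow> (nat \<times> nat) set \<Rightarrow> popart \<Rightarrow> (nat \<times> nat) set" where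
  "E1 n Gs Q = (case Q of (P, \<pi>) \<Rightarrow>
     {(a, b). a \<in> {1..n} \<and> b \<in> {1..n} \<and> a \<noteq> b \<and>
        \<not> dsep Gs a b (down P \<pi> {blk P a, blk P b} - {a, b})})"

definition E2 :: "nat \<Rightarrow> (nat \<times> nat) set \<Rightarrow> popart \<Rightarrow> (nat \<times> nat \<times> nat) set" where
  "E2 n Gs Q = (case Q of (P, \<pi>) \<Rightarrow>
     {(a, b, c). distinct [a, b, c] \<and> (a, b) \<in> E1 n Gs Q \<and> (c, b) \<in> E1 n Gs Q \<and>
        (a, c) \<notin> E1 n Gs Q \<and> le_max \<pi> (blk P b) {blk P a, blk P c}})"

definition E3 :: "nat \<Rightarrow> (nat \<times> nat) set \<Rightarrow> popart \<Rightarrow> (nat \<times> nat \<times> nat) set" where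
  "E3 n Gs Q = (case Q of (P, \<pi>) \<Rightarrow>
     {(a, b, c). distinct [a, b, c] \<and> (a, b) \<in> E1 n Gs Q \<and> (c, b) \<in> E1 n Gs Q \<and>
        (a, c) \<notin> E1 n Gs Q \<and>
        \<not> dsep Gs a c (down P \<pi> {blk P a, blk P b, blk P c} - {a, c})})"

definition E4 :: "nat \<Rightarrow> (nat \<times> nat) set \<Rightarrow> popart \<Rightarrow> ((nat \<times> nat \<times> nat) \<times> (nat \<times> nat \<times> nat)) set" where
  "E4 n Gs Q = (case Q of (P, \<pi>) \<Rightarrow>
     {((a, b1, c), (a, b2, c)) | a b1 c b2. distinct [a, b1, c] \<and> distinct [a, b2, c] \<and>
        (a, b1) \<in> E1 n Gs Q \<and> (c, b1) \<in> E1 n Gs Q \<and>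
        (a, b2) \<in> E1 n Gs Q \<and> (c, b2) \<in> E1 n Gs Q \<and> (a, c) \<notin> E1 n Gs Q \<and>
        (a, b1, c) \<notin> E2 n Gs Q \<union> E3 n Gs Q \<and> (a, b2, c) \<notin> E2 n Gs Q \<union> E3 n Gs Q \<and>
        (blk P b1, blk P b2) \<in> \<pi>})"

definition D :: "nat \<Rightarrow> (nat \<times> nat) set \<Rightarrow> nat \<Rightarrow> popart \<Rightarrow> nat list set" where
  "D n Gs t Q = (case Q of (P, \<pi>) \<Rightarrow>
     {xs. length xs = t + 2 \<and> distinct xs \<and>
        (\<forall>i\<le>t. (xs ! i, xs ! (i + 1)) \<in> E1 n Gs Q) \<and>
        (\<forall>i\<in>{2..t+1}. \<forall>j\<le>i - 2. (xs ! i, xs ! j) \<notin> E1 n Gs Q) \<and>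
        (\<forall>i\<in>{1..t}. blk P (xs ! i) = blk P (xs ! 1)) \<and>
        \<not> le_max \<pi> (blk P (xs ! 1)) {blk P (xs ! 0), blk P (xs ! (t + 1))}})"

definition E6 :: "nat \<Rightarrow> (nat \<times> nat) set \<Rightarrow> popart \<Rightarrow> (nat list \<times> (nat \<times> nat \<times> nat)) set" where
  "E6 n Gs Q = (case Q of (P, \<pi>) \<Rightarrow>
     (\<Union>t\<in>{1..n-2}. {(xs, (xs ! 0, b, xs ! (t + 1))) | xs b.
        distinct [xs ! 0, b, xs ! (t + 1)] \<and>
        (xs ! 0, b) \<in> E1 n Gs Q \<and> (xs ! (t + 1), b) \<in> E1 n Gs Q \<and>
        (xs ! 0, b, xs ! (t + 1)) \<notin> E2 n Gs Q \<union> E3 n Gs Q \<and>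
        xs \<in> D n Gs t Q \<and> (blk P (xs ! 1), blk P b) \<in> \<pi>}))"

definition argmin_on :: "'a set \<Rightarrow> ('a \<Rightarrow> nat) \<Rightarrow> 'a set" where
  "argmin_on A f = {x \<in> A. \<forall>y\<in>A. f x \<le> f y}"

definition argmax_on :: "'a set \<Rightarrow> ('a \<Rightarrow> nat) \<Rightarrow> 'a set" where
  "argmax_on A f = {x \<in> A. \<forall>y\<in>A. f y \<le> f x}"

definition S1 :: "nat \<Rightarrow> (nat \<times> nat) set \<Rightarrow> popart set" where
  "S1 n Gs = argmin_on (SS n) (\<lambda>Q. card (E1 n Gs Q))"
definition S2 :: "nat \<Rightarrow> (nat \<times> nat) set \<Rightarrow> popart set" where
  "S2 n Gs = argmin_on (S1 n Gs) (\<lambda>Q. card (E2 n Gs Q))"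
definition S3 :: "nat \<Rightarrow> (nat \<times> nat) set \<Rightarrow> popart set" where
  "S3 n Gs = argmin_on (S2 n Gs) (\<lambda>Q. card (E3 n Gs Q))"
definition S4 :: "nat \<Rightarrow> (nat \<times> nat) set \<Rightarrow> popart set" where
  "S4 n Gs = argmin_on (S3 n Gs) (\<lambda>Q. card (E4 n Gs Q))"

text \<open>S5 n Gs t = S_5^{(t)} for t \<ge> 1 (the value at t = 0 is irrelevant).\<close>
fun S5 :: "nat \<Rightarrow> (nat \<times> nat) set \<Rightarrow> nat \<Rightarrow> popart set" where
  "S5 n Gs 0 = S4 n Gs"
| "S5 n Gs (Suc 0) = S4 n Gs"
| "S5 n Gs (Suc (Suc k)) = argmax_on (S5 n Gs (Suc k)) (\<lambda>Q. card (D n Gs (Suc (Suc k)) Q))"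

definition S6 :: "nat \<Rightarrow> (nat \<times> nat) set \<Rightarrow> popart set" where
  "S6 n Gs = argmin_on (S5 n Gs (n - 2)) (\<lambda>Q. card (E6 n Gs Q))"

definition props :: "nat \<Rightarrow> (nat \<times> nat) set \<Rightarrow> popart \<Rightarrow> (nat \<times> nat) set \<Rightarrow> bool" where
  "props n Gs Q E \<longleftrightarrow> (case Q of (P, \<pi>) \<Rightarrow>
     (\<forall>a\<in>{1..n}. \<forall>b\<in>{1..n}. padj E a b \<longleftrightarrow> (a, b) \<in> E1 n Gs Q) \<and>
     (\<forall>a\<in>{1..n}. \<forall>b\<in>{1..n}. anc E a b \<longleftrightarrow> (blk P a, blk P b) \<in> \<pi>) \<and>
     (\<forall>a b c. (a, b, c) \<in> E3 n Gs Q \<and>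
        (\<forall>b'\<in>{1..n}. (blk P b', blk P b) \<in> \<pi> \<and> blk P b' \<noteq> blk P b \<longrightarrow> (a, b', c) \<notin> E3 n Gs Q)
        \<longrightarrow> (\<exists>d\<in>blk P b. (a, d) \<in> E \<and> (c, d) \<in> E)) \<and>
     (\<forall>a\<in>{1..n}. \<forall>b\<in>{1..n}. \<forall>c\<in>{1..n}. distinct [a, b, c] \<and>
        (a, b) \<in> E1 n Gs Q \<and> (c, b) \<in> E1 n Gs Q \<and> (a, c) \<notin> E1 n Gs Q \<and>
        \<not> le_max \<pi> (blk P b) {blk P a, blk P c} \<and> (a, b, c) \<notin> E3 n Gs Q
        \<longrightarrow> \<not> (\<exists>d\<in>blk P b. (a, d) \<in> E \<and> (c, d) \<in> E)))"

definition scc_part :: "nat \<Rightarrow> (nat \<times> nat) set \<Rightarrow> nat set set" where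
  "scc_part n G = {{j \<in> {1..n}. anc G i j \<and> anc G j i} | i. i \<in> {1..n}}"

definition scc_order :: "nat \<Rightarrow> (nat \<times> nat) set \<Rightarrow> (nat set \<times> nat set) set" where
  "scc_order n G = {(C1, C2). C1 \<in> scc_part n G \<and> C2 \<in> scc_part n G \<and>
      (C1 = C2 \<or> (\<exists>x\<in>C1. \<exists>y\<in>C2. anc G x y))}"

end

theory Submission
  imports Defs
begin

text \<open>Two facts carry the proof. First, d-connection of \<open>a\<close> and \<open>b\<close> given \<open>Z\<close> is reachability outside
  \<open>Z\<close> in the moral graph of the ancestors of \<open>Z \<union> {a, b}\<close>. It makes every step of the minimisation
  comparable with the partition of strongly connected components of \<open>G\<^sup>*\<close>: the sets \<open>E\<^sup>(\<^sup>1\<^sup>)\<close>, \<open>E\<^sup>(\<^sup>2\<^sup>)\<close>,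
  \<open>E\<^sup>(\<^sup>3\<^sup>)\<close>, \<open>E\<^sup>(\<^sup>4\<^sup>)\<close>, \<open>E\<^sup>(\<^sup>6\<^sup>)\<close> of any competitor contain those of \<open>G\<^sup>*\<close>, its \<open>D\<^sup>(\<^sup>t\<^sup>)\<close> are contained in
  those of \<open>G\<^sup>*\<close>, and so all of them coincide on \<open>S\<^sub>6\<close>. Second, a shortest path in the moral graph
  of one graph is a path in the moral graph of any other graph with the same sets: otherwise a
  strongly connected run of its vertices reaches \<open>Z \<union> {a, b}\<close> in only one of the two graphs, while
  in neither of them it reaches its two neighbours on the path, and following an ancestral path from
  the run to \<open>Z \<union> {a, b}\<close> produces an element of \<open>D\<^sup>(\<^sup>t\<^sup>)\<close> or \<open>E\<^sup>(\<^sup>6\<^sup>)\<close> that distinguishes the graphs.\<close>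

section \<open>The moral graph criterion for d-connection\<close>

text \<open>Two graphs with the same sets may have different ancestor relations, so the vertex sets
  of their moral graphs differ and the moral graphs cannot be compared edge by edge; the comparison
  is confined to shortest paths, whose vertices turn out to be ancestors in both. Cardinalities
  disappear at once: the partition of \<open>Gs\<close> is a candidate at every stage, so an
  inclusion between finite sets turns optimality into equality of the sets. The order of the stages
  matters, because each inclusion rests on equalities won before: \<open>D\<close> on
  \<open>D\<close> for smaller lengths, \<open>E6\<close> on \<open>E2\<close>, \<open>E3\<close>
  and \<open>D\<close>. The sets speak only of d-connection in \<open>Gs\<close>, whereas a marriage
  in another graph \<open>E\<close> needs an actual common child; properties (3) and (4) bridge this
  gap, while (1) and (2) settle adjacency and ancestry.\<close>

definition anset :: "(nat \<times> nat) set \<Rightarrow> nat set \<Rightarrow> nat set" where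
  "anset E T = {x. \<exists>w\<in>T. anc E x w}"

text \<open>A walk is its start vertex together with the list of its steps \<open>(d, y)\<close>: the next vertex is
  \<open>y\<close>, entered along the edge if \<open>d\<close> and against it otherwise. The argument \<open>din\<close> is the direction of
  the preceding step, or \<open>None\<close> at the start, which is exempt from the collider conditions;
  colliders have to lie in \<open>C\<close>.\<close>
fun awalk :: "(nat \<times> nat) set \<Rightarrow> nat set \<Rightarrow> nat set \<Rightarrow> nat \<Rightarrow> bool option \<Rightarrow> (bool \<times> nat) list \<Rightarrow> bool" where
  "awalk E C Z x din [] \<longleftrightarrow> True"
| "awalk E C Z x din ((d, y) # s) \<longleftrightarrow>
     (if d then (x, y) \<in> E else (y, x) \<in> E) \<and>
     (din \<noteq> None \<longrightarrow> (if din = Some True \<and> \<not> d then x \<in> C else x \<notin> Z)) \<and>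
     awalk E C Z y (Some d) s"

fun wend :: "nat \<Rightarrow> (bool \<times> nat) list \<Rightarrow> nat" where
  "wend x [] = x"
| "wend x ((d, y) # s) = wend y s"

fun wdir :: "bool option \<Rightarrow> (bool \<times> nat) list \<Rightarrow> bool option" where
  "wdir din [] = din"
| "wdir din ((d, y) # s) = wdir (Some d) s"

lemma awalk_append:
  "awalk E C Z x din (s @ s') \<longleftrightarrow> awalk E C Z x din s \<and> awalk E C Z (wend x s) (wdir din s) s'"
  by (induction s arbitrary: x din) auto

lemma wend_append: "wend x (s @ s') = wend (wend x s) s'"
  by (induction s arbitrary: x) auto

lemma wend_last: "wend x s = last (x # map snd s)"
  by (induction s arbitrary: x) auto

lemma wdir_nonempty: "s \<noteq> [] \<Longrightarrow> wdir din s = Some (fst (last s))"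
  by (induction s arbitrary: din) auto

definition astep :: "(nat \<times> nat) set \<Rightarrow> nat set \<Rightarrow> nat set \<Rightarrow> bool option \<Rightarrow> nat \<Rightarrow> bool \<times> nat \<Rightarrow> bool" where
  "astep E C Z din x p \<longleftrightarrow> (if fst p then (x, snd p) \<in> E else (snd p, x) \<in> E) \<and>
     (din \<noteq> None \<longrightarrow> (if din = Some True \<and> \<not> fst p then x \<in> C else x \<notin> Z))"

lemma awalk_nth:
  "awalk E C Z x din s \<longleftrightarrow>
     (\<forall>i<length s. astep E C Z (if i = 0 then din else Some (fst (s ! (i - 1)))) ((x # map snd s) ! i) (s ! i))"
proof (induction s arbitrary: x din)
  case (Cons p s)
  have *: "(if i = 0 then Some (fst p) else Some (fst (s ! (i - 1)))) = Some (fst ((p # s) ! i))" for i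
    by (simp add: nth_Cons')
  have "awalk E C Z x din (p # s) \<longleftrightarrow> astep E C Z din x p \<and> awalk E C Z (snd p) (Some (fst p)) s"
    by (cases p) (auto simp: astep_def)
  also have "\<dots> \<longleftrightarrow> astep E C Z din x p \<and>
      (\<forall>i<length s. astep E C Z (Some (fst ((p # s) ! i))) ((snd p # map snd s) ! i) (s ! i))"
    unfolding Cons.IH * ..
  finally show ?case by (simp add: All_less_Suc2)
qed simp

text \<open>\<open>dconn\<close> demands at least one edge, while the empty step list is an
  \<open>awalk\<close>; \<open>a \<noteq> b\<close> closes this gap.\<close>

lemma dconn_awalk:
  assumes "a \<noteq> b"
  shows "dconn E a b Z \<longleftrightarrow>
    (\<exists>s. awalk E (anset E Z) Z a None s \<and> wend a s = b \<and> distinct (a # map snd s))"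
proof
  assume "dconn E a b Z"
  then obtain vs ds where h: "length vs \<ge> 2" "hd vs = a" "last vs = b" "distinct vs"
      "length ds = length vs - 1"
      "\<forall>i < length ds. if ds ! i then (vs ! i, vs ! Suc i) \<in> E else (vs ! Suc i, vs ! i) \<in> E"
      "\<forall>i. 0 < i \<and> i < length vs - 1 \<longrightarrow>
          (if ds ! (i - 1) \<and> \<not> ds ! i then (\<exists>z\<in>Z. anc E (vs ! i) z) else vs ! i \<notin> Z)"
    unfolding dconn_def by blast
  define s where "s = zip ds (tl vs)"
  have l: "length s = length ds" and m: "map snd s = tl vs" and f: "\<And>i. i < length ds \<Longrightarrow> fst (s ! i) = ds ! i"
    using h(5) by (auto simp: s_def)
  have vs: "a # map snd s = vs" using h(1,2) m by (cases vs) auto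
  have sn: "snd (s ! i) = vs ! Suc i" if "i < length ds" for i
    using that vs l by (metis nth_Cons_Suc nth_map)
  have "awalk E (anset E Z) Z a None s"
    unfolding awalk_nth astep_def vs l using h(5,6,7) f sn by (auto simp: anset_def)
  then show "\<exists>s. awalk E (anset E Z) Z a None s \<and> wend a s = b \<and> distinct (a # map snd s)"
    using vs h(3,4) wend_last by metis
next
  assume "\<exists>s. awalk E (anset E Z) Z a None s \<and> wend a s = b \<and> distinct (a # map snd s)"
  then obtain s where s: "awalk E (anset E Z) Z a None s" "wend a s = b" "distinct (a # map snd s)"
    by blast
  have "s \<noteq> []" using s(2) assms by auto
  define vs where "vs = a # map snd s"
  define ds where "ds = map fst s"
  note aw = s(1)[unfolded awalk_nth astep_def, folded vs_def]
  have sn: "snd (s ! i) = vs ! Suc i" if "i < length s" for i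
    using that by (simp add: vs_def)
  have "length vs \<ge> 2" using \<open>s \<noteq> []\<close> by (cases s) (auto simp: vs_def)
  moreover have "hd vs = a" "last vs = b" "distinct vs" "length ds = length vs - 1"
    using s wend_last[of a s] by (auto simp: vs_def ds_def)
  moreover have "\<forall>i < length ds. if ds ! i then (vs ! i, vs ! Suc i) \<in> E else (vs ! Suc i, vs ! i) \<in> E"
    using aw sn by (auto simp: ds_def)
  moreover have "\<forall>i. 0 < i \<and> i < length vs - 1 \<longrightarrow>
          (if ds ! (i - 1) \<and> \<not> ds ! i then (\<exists>z\<in>Z. anc E (vs ! i) z) else vs ! i \<notin> Z)"
  proof (intro allI impI)
    fix i assume i: "0 < i \<and> i < length vs - 1"
    then have "i < length s" by (simp add: vs_def)
    then show "if ds ! (i - 1) \<and> \<not> ds ! i then (\<exists>z\<in>Z. anc E (vs ! i) z) else vs ! i \<notin> Z"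
      using aw[rule_format, of i] i by (auto simp: ds_def anset_def)
  qed
  ultimately show "dconn E a b Z" unfolding dconn_def by blast
qed

lemma anc_refl [simp]: "anc E x x" by (simp add: anc_def)

lemma anc_trans [trans]: "anc E x y \<Longrightarrow> anc E y z \<Longrightarrow> anc E x z" by (simp add: anc_def)

lemma anc_edge: "(x, y) \<in> E \<Longrightarrow> anc E x y" by (auto simp: anc_def)

lemma anset_closed: "anc E x y \<Longrightarrow> y \<in> anset E T \<Longrightarrow> x \<in> anset E T"
  unfolding anset_def using anc_trans by blast

lemma anset_self: "T \<subseteq> anset E T" unfolding anset_def using anc_refl by blast

lemma anset_mono: "T \<subseteq> T' \<Longrightarrow> anset E T \<subseteq> anset E T'" unfolding anset_def by blast

lemma awalk_weaken: "awalk E C Z x din s \<Longrightarrow> awalk E C Z x None s"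
  by (cases s) auto

text \<open>While its steps go forward the walk is a directed path; it either runs to its end or
  turns at a first collider, which lies in \<open>anset E Z\<close>.\<close>

lemma awalk_out_of_tail:
  assumes "awalk E (anset E Z) Z x din ((True, y) # s)"
  shows "y \<in> anset E (Z \<union> {wend y s})"
  using assms
proof (induction s arbitrary: x y din)
  case Nil
  then show ?case by (auto simp: anset_def)
next
  case (Cons p s)
  obtain d w where p: "p = (d, w)" by (cases p)
  show ?case
  proof (cases d)
    case True
    then have "awalk E (anset E Z) Z y (Some True) ((True, w) # s)" using Cons.prems p by simp
    from Cons.IH[OF this] have "w \<in> anset E (Z \<union> {wend w s})" .
    then show ?thesis using Cons.prems p True by (auto intro: anset_closed anc_edge)
  next
    case False
    then have "y \<in> anset E Z" using Cons.prems p by simp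
    then show ?thesis using anset_mono[of Z "Z \<union> {wend y (p # s)}" E] by blast
  qed
qed

text \<open>The marriage clause does not ask for \<open>u \<noteq> v\<close>, so loops may occur.
  They do not affect reachability, but a genuine marriage has to be secured by injectivity of the
  path.\<close>

definition moral :: "(nat \<times> nat) set \<Rightarrow> nat set \<Rightarrow> nat set \<Rightarrow> (nat \<times> nat) set" where
  "moral E T Z = {(u, v). u \<in> anset E T - Z \<and> v \<in> anset E T - Z \<and>
     ((u, v) \<in> E \<or> (v, u) \<in> E \<or> (\<exists>c\<in>anset E T. (u, c) \<in> E \<and> (v, c) \<in> E))}"

text \<open>A collider inside \<open>Z\<close> is no vertex of the moral graph, but its two
  neighbours on the walk are parents of a common child in \<open>anset E T\<close>, so one marriage
  replaces two steps. Hence the induction on the length.\<close>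

lemma awalk_imp_moral:
  assumes "awalk E (anset E Z) Z x din s" "wend x s = b" "b \<notin> Z" "x \<in> anset E T - Z" "T = Z \<union> {a, b}"
  shows "(x, b) \<in> (moral E T Z)\<^sup>*"
  using assms
proof (induction "length s" arbitrary: s x din rule: less_induct)
  case less
  have sub: "anset E Z \<subseteq> anset E T" "anset E (Z \<union> {b}) \<subseteq> anset E T"
    using less.prems by (auto intro!: anset_mono)
  show ?case
  proof (cases s)
    case Nil
    then show ?thesis using less.prems by simp
  next
    case (Cons p s')
    obtain d y where p: "p = (d, y)" by (cases p)
    have w: "awalk E (anset E Z) Z y (Some d) s'" "wend y s' = b"
      and e: "if d then (x, y) \<in> E else (y, x) \<in> E"
      using less.prems Cons p by auto
    have yA: "y \<in> anset E T"
    proof (cases d)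
      case True
      then have "y \<in> anset E (Z \<union> {wend y s'})"
        using less.prems(1) Cons p awalk_out_of_tail[of E Z x din y s'] by simp
      then show ?thesis using sub w by auto
    next
      case False
      then show ?thesis using e less.prems anset_closed[OF anc_edge] by auto
    qed
    show ?thesis
    proof (cases "y \<in> Z")
      case False
      then have "(x, y) \<in> moral E T Z" using e yA less.prems by (auto simp: moral_def split: if_splits)
      moreover have "(y, b) \<in> (moral E T Z)\<^sup>*"
        using less.hyps[of s' y "Some d"] w less.prems False yA Cons by simp
      ultimately show ?thesis by (rule converse_rtrancl_into_rtrancl)
    next
      case True
      then have "s' \<noteq> []" using w less.prems by auto
      then obtain d2 y2 s'' where s': "s' = (d2, y2) # s''" by (cases s') auto
      have d: "d" "\<not> d2" using w True s' by (auto split: if_splits)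
      have e2: "(y2, y) \<in> E" and w2: "awalk E (anset E Z) Z y2 (Some False) s''" "wend y2 s'' = b"
        using w s' d by auto
      \<comment> \<open>\<open>y2\<close> is either the end \<open>b\<close> or entered against an
        edge, hence no collider.\<close>
      have y2: "y2 \<notin> Z"
      proof (cases s'')
        case Nil then show ?thesis using w2 less.prems by auto
      next
        case (Cons q r) then show ?thesis using w2 by (cases q) auto
      qed
      have y2A: "y2 \<in> anset E T" using e2 yA anset_closed[OF anc_edge] by blast
      have "(x, y2) \<in> moral E T Z" using e d e2 yA y2 y2A less.prems by (auto simp: moral_def)
      moreover have "(y2, b) \<in> (moral E T Z)\<^sup>*"
        using less.hyps[of s'' y2 "Some False"] w2 less.prems y2 y2A Cons s' by simp
      ultimately show ?thesis by (rule converse_rtrancl_into_rtrancl)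
    qed
  qed
qed

text \<open>Vertices of the moral graph lie in \<open>anset E T\<close> and outside
  \<open>Z\<close>, so they pass as colliders and as non-colliders; hence \<open>din\<close> is
  arbitrary. A marriage becomes a detour through the child. The price is that colliders are
  ancestors of \<open>T\<close> rather than of \<open>Z\<close>.\<close>

lemma moral_imp_awalk:
  assumes "(x, b) \<in> (moral E T Z)\<^sup>*"
  shows "\<exists>s. awalk E (anset E T) Z x (Some din) s \<and> wend x s = b"
  using assms
proof (induction arbitrary: din rule: converse_rtrancl_induct)
  case base
  show ?case by (rule exI[of _ "[]"]) simp
next
  case (step u v)
  from step.hyps(1) consider "(u, v) \<in> E" | "(v, u) \<in> E"
    | c where "c \<in> anset E T" "(u, c) \<in> E" "(v, c) \<in> E"
    by (auto simp: moral_def)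
  then show ?case
  proof cases
    case 1
    obtain s where "awalk E (anset E T) Z v (Some True) s \<and> wend v s = b" using step.IH by blast
    then show ?thesis using 1 step.hyps(1) by (intro exI[of _ "(True, v) # s"]) (auto simp: moral_def)
  next
    case 2
    obtain s where "awalk E (anset E T) Z v (Some False) s \<and> wend v s = b" using step.IH by blast
    then show ?thesis using 2 step.hyps(1) by (intro exI[of _ "(False, v) # s"]) (auto simp: moral_def)
  next
    case 3
    obtain s where "awalk E (anset E T) Z v (Some False) s \<and> wend v s = b" using step.IH by blast
    then show ?thesis using 3 step.hyps(1)
      by (intro exI[of _ "(True, c) # (False, v) # s"]) (auto simp: moral_def)
  qed
qed

text \<open>Descendants of a vertex that does not reach \<open>Z\<close> avoid \<open>Z\<close>, and
  a directed path has no colliders, so \<open>C\<close> may be any set.\<close>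

lemma directed_awalk:
  assumes "anc E x b" "x \<notin> anset E Z"
  shows "\<exists>s. awalk E C Z x (Some True) s \<and> wend x s = b"
  using assms unfolding anc_def
proof (induction rule: converse_rtrancl_induct)
  case base
  show ?case by (rule exI[of _ "[]"]) simp
next
  case (step u v)
  then have "v \<notin> anset E Z" using anset_closed[OF anc_edge] by blast
  then obtain s where "awalk E C Z v (Some True) s \<and> wend v s = b" using step.IH by blast
  moreover have "u \<notin> Z" using step.prems anset_self by blast
  ultimately show ?case using step.hyps(1) by (intro exI[of _ "(True, v) # s"]) auto
qed

text \<open>The directed path from \<open>x\<close> to \<open>a\<close> is walked backwards. It
  arrives at \<open>x\<close> against an edge, which is why \<open>s\<close> has to be valid after
  \<open>Some False\<close>.\<close>

lemma awalk_reverse_directed: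
  assumes "anc E x a" "x \<notin> anset E Z" "awalk E C Z x (Some False) s"
  shows "\<exists>s'. awalk E C Z a None s' \<and> wend a s' = wend x s"
  using assms unfolding anc_def
proof (induction arbitrary: s rule: converse_rtrancl_induct)
  case base
  then show ?case using awalk_weaken by blast
next
  case (step u v)
  then have "v \<notin> anset E Z" using anset_closed[OF anc_edge] by blast
  moreover have "v \<notin> Z" using calculation anset_self by blast
  ultimately show ?case using step.IH[of "(False, u) # s"] step.hyps(1) step.prems by auto
qed

text \<open>A collider that reaches an endpoint but not \<open>Z\<close> is bypassed along the directed path to that
  endpoint.\<close>
lemma awalk_shrink_colliders:
  assumes "awalk E (anset E (Z \<union> {a, b})) Z x (Some din) s" "wend x s = b"
  shows "(\<exists>s'. awalk E (anset E Z) Z a None s' \<and> wend a s' = b) \<or>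
         (\<exists>s'. awalk E (anset E Z) Z x (Some din) s' \<and> wend x s' = b)"
  using assms
proof (induction s arbitrary: x din)
  case Nil
  then show ?case by (intro disjI2 exI[of _ "[]"]) simp
next
  case (Cons p s)
  obtain d y where p: "p = (d, y)" by (cases p)
  have w: "awalk E (anset E (Z \<union> {a, b})) Z y (Some d) s" "wend y s = b"
    and e: "if d then (x, y) \<in> E else (y, x) \<in> E"
    using Cons.prems p by auto
  from Cons.IH[OF w] show ?case
  proof
    assume "\<exists>s'. awalk E (anset E Z) Z a None s' \<and> wend a s' = b" then show ?thesis ..
  next
    assume "\<exists>s'. awalk E (anset E Z) Z y (Some d) s' \<and> wend y s' = b"
    then obtain s' where s': "awalk E (anset E Z) Z y (Some d) s'" "wend y s' = b" by blast
    show ?thesis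
    proof (cases "din \<and> \<not> d \<and> x \<notin> anset E Z")
      case False
      then have "awalk E (anset E Z) Z x (Some din) ((d, y) # s')"
        using Cons.prems p s' by (auto split: if_splits)
      then show ?thesis using s'(2) by (intro disjI2 exI[of _ "(d, y) # s'"]) simp
    next
      case True
      then have "x \<in> anset E (Z \<union> {a, b})" using Cons.prems p by auto
      then consider "anc E x a" | "anc E x b" using True by (auto simp: anset_def)
      then show ?thesis
      proof cases
        case 1
        have "x \<notin> Z" using True anset_self by blast
        then have "awalk E (anset E Z) Z x (Some False) ((d, y) # s')" using s' True e by auto
        from awalk_reverse_directed[OF 1 _ this] True s' show ?thesis by auto
      next
        case 2
        then show ?thesis using directed_awalk[OF 2] True by auto
      qed
    qed
  qed
qed

text \<open>Leaving a vertex through a tail and coming back through a tail forces a collider in between,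
  so the vertex is an ancestor of the conditioning set.\<close>
lemma awalk_loop_ancestor:
  assumes "awalk E (anset E Z) Z x (Some True) ((True, y) # s)" "wdir (Some True) s = Some False"
  shows "y \<in> anset E Z"
  using assms
proof (induction s arbitrary: x y)
  case Nil
  then show ?case by simp
next
  case (Cons p s)
  obtain d w where p: "p = (d, w)" by (cases p)
  show ?case
  proof (cases d)
    case True
    then have "awalk E (anset E Z) Z y (Some True) ((True, w) # s)" "wdir (Some True) s = Some False"
      using Cons.prems p by auto
    from Cons.IH[OF this] have "w \<in> anset E Z" .
    then show ?thesis using Cons.prems p True by (auto intro: anset_closed anc_edge)
  next
    case False
    then show ?thesis using Cons.prems p by simp
  qed
qed

text \<open>Only the condition at \<open>v\<close> changes. If \<open>v\<close> becomes a collider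
  without having been one at either visit, the removed loop leaves along an edge and returns against
  one, so \<open>awalk_loop_ancestor\<close> applies. If \<open>v\<close> ends up a non-collider, it
  was one at one of the two visits.\<close>

lemma awalk_splice:
  assumes w: "awalk E (anset E Z) Z x None (s1 @ s2 @ s3)"
    and v: "wend x s1 = v" "wend v s2 = v"
  shows "awalk E (anset E Z) Z x None (s1 @ s3)"
proof -
  have w1: "awalk E (anset E Z) Z x None s1" and w2: "awalk E (anset E Z) Z v (wdir None s1) s2"
    and w3: "awalk E (anset E Z) Z v (wdir (wdir None s1) s2) s3"
    using w v by (auto simp: awalk_append)
  have "awalk E (anset E Z) Z v (wdir None s1) s3"
  proof (cases "s1 = [] \<or> s2 = [] \<or> s3 = []")
    case True
    then show ?thesis using w3 awalk_weaken by auto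
  next
    case False
    then obtain d1 d2 where d1: "wdir None s1 = Some d1" and d2: "wdir (Some d1) s2 = Some d2"
      using wdir_nonempty by blast
    obtain d3 y3 r3 where s3: "s3 = (d3, y3) # r3" using False by (cases s3) auto
    obtain d y r where s2: "s2 = (d, y) # r" using False by (cases s2) auto
    have c2: "if d1 \<and> \<not> d then v \<in> anset E Z else v \<notin> Z" and w2': "awalk E (anset E Z) Z y (Some d) r"
      and e2: "if d then (v, y) \<in> E else (y, v) \<in> E"
      using w2 d1 s2 by (auto split: if_splits)
    have c3: "if d2 \<and> \<not> d3 then v \<in> anset E Z else v \<notin> Z"
      using w3 d1 d2 s3 by (auto split: if_splits)
    have "if d1 \<and> \<not> d3 then v \<in> anset E Z else v \<notin> Z"
    proof (cases "d1 \<and> \<not> d3")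
      case True
      have "v \<in> anset E Z"
      proof (cases "d \<and> \<not> d2")
        case True
        have "awalk E (anset E Z) Z v (Some True) ((True, y) # r)" using True w2 d1 s2 \<open>d1 \<and> \<not> d3\<close> by auto
        moreover have "wdir (Some True) r = Some False" using d2 s2 True by simp
        ultimately have "y \<in> anset E Z" by (rule awalk_loop_ancestor)
        then show ?thesis using e2 True by (auto intro: anset_closed anc_edge)
      next
        case False
        then show ?thesis using c2 c3 \<open>d1 \<and> \<not> d3\<close> by (auto split: if_splits)
      qed
      then show ?thesis using True by simp
    next
      case False
      then show ?thesis using c2 c3 by (auto split: if_splits)
    qed
    then show ?thesis using w3 s3 d1 d2 by auto
  qed
  then show ?thesis using w1 v by (simp add: awalk_append)
qed

text \<open>A walk of least length repeats no vertex, since \<open>awalk_splice\<close> would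
  shorten it.\<close>

lemma awalk_distinct:
  assumes "awalk E (anset E Z) Z a None s" "wend a s = b"
  shows "\<exists>s. awalk E (anset E Z) Z a None s \<and> wend a s = b \<and> distinct (a # map snd s)"
proof -
  let ?P = "\<lambda>s. awalk E (anset E Z) Z a None s \<and> wend a s = b"
  obtain s where s: "?P s" and min: "\<And>s'. ?P s' \<Longrightarrow> length s \<le> length s'"
    using assms ex_has_least_nat[of ?P s length] by blast
  have "distinct (a # map snd s)"
  proof (rule ccontr)
    assume "\<not> ?thesis"
    then obtain i j where ij: "i < j" "j \<le> length s" "(a # map snd s) ! i = (a # map snd s) ! j"
      unfolding distinct_conv_nth by (metis length_Cons length_map less_Suc_eq_le linorder_neqE_nat)
    have we: "wend a (take k s) = (a # map snd s) ! k" if "k \<le> length s" for k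
      using that by (cases k) (auto simp: wend_last last_conv_nth take_map[symmetric])
    define s2 where "s2 = take (j - i) (drop i s)"
    have dec: "s = take i s @ s2 @ drop j s"
      unfolding s2_def using ij(1)
      by (metis append_assoc append_take_drop_id le_add_diff_inverse less_imp_le take_add)
    have tj: "take j s = take i s @ s2"
      unfolding s2_def using ij(1) by (metis le_add_diff_inverse less_imp_le take_add)
    have "wend (wend a (take i s)) s2 = wend a (take i s)"
      using we[of i] we[of j] ij tj by (metis less_imp_le less_le_trans wend_append)
    then have "?P (take i s @ drop j s)"
      using s dec awalk_splice[of E Z a "take i s" s2 "drop j s"] by (metis wend_append)
    from min[OF this] ij show False by simp
  qed
  then show ?thesis using s by blast
qed

theorem dconn_iff_moral:
  assumes "a \<noteq> b" "a \<notin> Z" "b \<notin> Z"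
  shows "dconn E a b Z \<longleftrightarrow> (a, b) \<in> (moral E (Z \<union> {a, b}) Z)\<^sup>*"
proof
  assume "dconn E a b Z"
  then obtain s where "awalk E (anset E Z) Z a None s" "wend a s = b"
    unfolding dconn_awalk[OF assms(1)] by blast
  moreover have "a \<in> anset E (Z \<union> {a, b}) - Z" using assms anset_self[of "Z \<union> {a, b}" E] by blast
  ultimately show "(a, b) \<in> (moral E (Z \<union> {a, b}) Z)\<^sup>*"
    using awalk_imp_moral[of E Z a None s b "Z \<union> {a, b}" a] assms by simp
next
  assume "(a, b) \<in> (moral E (Z \<union> {a, b}) Z)\<^sup>*"
  from moral_imp_awalk[OF this, of True]
  obtain s where "awalk E (anset E (Z \<union> {a, b})) Z a (Some True) s" "wend a s = b" by blast
  from awalk_shrink_colliders[OF this]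
  obtain s' where "awalk E (anset E Z) Z a None s'" "wend a s' = b" using awalk_weaken by blast
  from awalk_distinct[OF this] show "dconn E a b Z" unfolding dconn_awalk[OF assms(1)] .
qed

section \<open>Shortest paths and sink runs\<close>

lemma shortest_path:
  assumes "(u, z) \<in> R\<^sup>*"
  obtains f and n :: nat where "f 0 = u" "f n = z" "\<And>i. i < n \<Longrightarrow> (f i, f (Suc i)) \<in> R"
    "\<And>i j. Suc i < j \<Longrightarrow> j \<le> n \<Longrightarrow> (f i, f j) \<notin> R" "inj_on f {..n}"
proof -
  define n where "n = (LEAST n. (u, z) \<in> R ^^ n)"
  have n: "(u, z) \<in> R ^^ n"
    unfolding n_def using assms rtrancl_power LeastI_ex by metis
  have min: "n \<le> m" if "(u, z) \<in> R ^^ m" for m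
    unfolding n_def using that by (rule Least_le)
  from n obtain f where f: "f 0 = u" "f n = z" "\<And>i. i < n \<Longrightarrow> (f i, f (Suc i)) \<in> R"
    unfolding relpow_fun_conv by blast
  have seg: "(f i, f j) \<in> R ^^ (j - i)" if "i \<le> j" "j \<le> n" for i j
    unfolding relpow_fun_conv using that f by (intro exI[of _ "\<lambda>k. f (i + k)"]) auto
  \<comment> \<open>Replacing the stretch from \<open>f i\<close> to \<open>f j\<close> by
    \<open>m\<close> steps cannot beat the minimum \<open>n\<close>; \<open>m = 1\<close> forbids
    chords and \<open>m = 0\<close> forbids repetitions.\<close>
  have short: "n \<le> i + m + (n - j)" if "(f i, f j) \<in> R ^^ m" "i \<le> n" "j \<le> n" for i j m
  proof (rule min)
    have "(u, f i) \<in> R ^^ i" "(f j, z) \<in> R ^^ (n - j)" using seg[of 0 i] seg[of j n] f that by auto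
    then show "(u, z) \<in> R ^^ (i + m + (n - j))" using that unfolding relpow_add by blast
  qed
  have chord: "(f i, f j) \<notin> R" if "Suc i < j" "j \<le> n" for i j
    using short[of i j 1] that by auto
  have "f i \<noteq> f j" if "i < j" "j \<le> n" for i j
    using short[of i j 0] that by auto
  then have "inj_on f {..n}"
    by (auto simp: inj_on_def) (metis linorder_neqE_nat)
  with f chord that show thesis by blast
qed

text \<open>Among the indices whose vertices do not reach \<open>T\<close>, one that reaches fewest
  of the others lies in a sink class: whatever it reaches there reaches back. \<open>{k..l}\<close>
  is the maximal interval around it within that class. A neighbour reached from the class would not
  reach \<open>T\<close> either, hence belong to the class, against maximality. The run may start at
  index 0, so the left exit is conditional; \<open>p\<close> bounds it on the right.\<close>

lemma anc_sink_run:
  fixes f :: "nat \<Rightarrow> nat" and p :: nat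
  assumes p: "f p \<in> anset E T" and i: "i \<le> p" "f i \<notin> anset E T"
  obtains k l where "k \<le> l" "l < p" "\<And>i. i \<in> {k..l} \<Longrightarrow> f i \<notin> anset E T"
    "\<And>i j. i \<in> {k..l} \<Longrightarrow> j \<in> {k..l} \<Longrightarrow> anc E (f i) (f j)"
    "\<And>i. i \<in> {k..l} \<Longrightarrow> \<not> anc E (f i) (f (Suc l))"
    "\<And>i. i \<in> {k..l} \<Longrightarrow> k > 0 \<Longrightarrow> \<not> anc E (f i) (f (k - 1))"
proof -
  define le where "le = anc E"
  note refl = anc_refl[of E, folded le_def] and trans = anc_trans[of E, folded le_def]
  define N where "N = {i. i \<le> p \<and> f i \<notin> anset E T}"
  have N: "N \<subseteq> {..p}" "N \<noteq> {}" "p \<notin> N" using p i by (auto simp: N_def)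
  have closed: "j \<in> N" if "i \<in> N" "j \<le> p" "le (f i) (f j)" for i j
    using that anset_closed[OF that(3)[unfolded le_def]] by (auto simp: N_def)
  define U where "U i = card {j \<in> N. le (f i) (f j)}" for i
  have fin: "finite N" using N finite_subset by blast
  obtain i0 where i0: "i0 \<in> N" and least: "\<And>i. i \<in> N \<Longrightarrow> U i0 \<le> U i"
    using N(2) ex_has_least_nat[of "\<lambda>i. i \<in> N" _ U] by blast
  have max: "le (f j) (f i0)" if "j \<in> N" "le (f i0) (f j)" for j
  proof (rule ccontr)
    assume "\<not> ?thesis"
    then have "{i \<in> N. le (f j) (f i)} \<subset> {i \<in> N. le (f i0) (f i)}"
      using trans[OF that(2)] refl[of "f i0"] i0 by (intro psubsetI) (blast, blast)
    then have "U j < U i0" unfolding U_def using fin by (intro psubset_card_mono) auto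
    with least[OF that(1)] show False by simp
  qed
  define eq where "eq i \<longleftrightarrow> le (f i0) (f i) \<and> le (f i) (f i0)" for i
  have "i0 \<le> p" "i0 \<noteq> p" using i0 N by auto
  then have i0p: "i0 < p" by simp
  have eqN: "i \<in> N" if "eq i" "i \<le> p" for i using closed[OF i0 that(2)] that(1) by (simp add: eq_def)
  have notp: "\<not> eq p" using eqN N by blast
  define l where "l = (LEAST l. i0 \<le> l \<and> \<not> eq (Suc l))"
  have "i0 \<le> p - 1 \<and> \<not> eq (Suc (p - 1))" using i0p notp by auto
  from LeastI[of "\<lambda>l. i0 \<le> l \<and> \<not> eq (Suc l)", OF this] Least_le[of "\<lambda>l. i0 \<le> l \<and> \<not> eq (Suc l)", OF this]
  have l: "i0 \<le> l" "\<not> eq (Suc l)" "l \<le> p - 1" unfolding l_def by simp_all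
  have up: "eq i" if "i0 \<le> i" "i \<le> l" for i
  proof (cases "i = i0")
    case True then show ?thesis using refl by (simp add: eq_def)
  next
    case False
    then have "i0 \<le> i - 1" "i - 1 < l" using that by auto
    then have "eq (Suc (i - 1))" using not_less_Least[of "i - 1" "\<lambda>l. i0 \<le> l \<and> \<not> eq (Suc l)"]
      unfolding l_def by blast
    then show ?thesis using False that by simp
  qed
  define k where "k = (LEAST k. k \<le> i0 \<and> (\<forall>i\<in>{k..i0}. eq i))"
  have "i0 \<le> i0 \<and> (\<forall>i\<in>{i0..i0}. eq i)" using refl by (auto simp: eq_def)
  from LeastI[of "\<lambda>k. k \<le> i0 \<and> (\<forall>i\<in>{k..i0}. eq i)", OF this, folded k_def]
  have k: "k \<le> i0" "\<forall>i\<in>{k..i0}. eq i" by blast+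
  have kmin: "\<not> eq (k - 1)" if "k > 0"
  proof
    assume eqk: "eq (k - 1)"
    have "eq i" if "i \<in> {k - 1..i0}" for i
      using that eqk k(2) by (cases "i = k - 1") auto
    then have "k - 1 \<le> i0 \<and> (\<forall>i\<in>{k - 1..i0}. eq i)" using k(1) by auto
    then have "k \<le> k - 1" unfolding k_def by (rule Least_le)
    with that show False by simp
  qed
  have all: "eq i" if "i \<in> {k..l}" for i using that up k by (cases "i0 \<le> i") auto
  have notle: "\<not> le (f i) (f j)" if "i \<in> {k..l}" "\<not> eq j" "j \<le> p" for i j
  proof
    assume "le (f i) (f j)"
    with all[OF that(1)] have "le (f i0) (f j)" unfolding eq_def by (elim conjE) (rule trans)
    then have "eq j" using closed[OF i0 that(3)] max[of j] unfolding eq_def by simp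
    with that show False by blast
  qed
  show thesis
  proof (rule that[of k l])
    show "k \<le> l" "l < p" using k l i0p by auto
    show "f i \<notin> anset E T" if "i \<in> {k..l}" for i
      using eqN[OF all[OF that]] that \<open>l < p\<close> by (simp add: N_def)
    show "anc E (f i) (f j)" if "i \<in> {k..l}" "j \<in> {k..l}" for i j
      using trans[of "f i" "f i0" "f j"] all[OF that(1)] all[OF that(2)] unfolding eq_def le_def by simp
    show "\<not> anc E (f i) (f (Suc l))" if "i \<in> {k..l}" for i
      using notle[OF that l(2), unfolded le_def] \<open>l < p\<close> by simp
    show "\<not> anc E (f i) (f (k - 1))" if "i \<in> {k..l}" "k > 0" for i
      using notle[OF that(1) kmin[OF that(2)], unfolded le_def] \<open>k \<le> l\<close> \<open>l < p\<close> by simp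
  qed
qed

lemma padj_sym: "padj E a b \<longleftrightarrow> padj E b a" unfolding padj_def by blast

lemma chain_anc:
  assumes "\<And>i. i < m \<Longrightarrow> anc E (y i) (y (Suc i))" "i \<le> j" "j \<le> m"
  shows "anc E (y i) (y j)"
  using assms(2,3)
proof (induction rule: dec_induct)
  case (step k)
  then show ?case using assms(1)[of k] anc_trans by simp
qed simp

text \<open>Directed paths need not be free of shortcuts with respect to \<open>p\<close>-adjacency, whereas paths
  of \<open>p\<close>-adjacent ancestors can be shortened.\<close>
lemma uncovered_ancestral_path:
  assumes "anc E x w"
  obtains y and m :: nat where "y 0 = x" "y m = w"
    "\<And>i. i < m \<Longrightarrow> padj E (y i) (y (Suc i))" "\<And>i. i < m \<Longrightarrow> anc E (y i) (y (Suc i))"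
    "\<And>i j. Suc i < j \<Longrightarrow> j \<le> m \<Longrightarrow> \<not> padj E (y i) (y j)" "inj_on y {..m}"
proof -
  define R where "R = {(x, y). padj E x y \<and> anc E x y}"
  have "(x, w) \<in> R\<^sup>*"
    using assms unfolding anc_def
  proof (induction rule: rtrancl_induct)
    case (step y z)
    show ?case
    proof (cases "y = z")
      case False
      then have "(y, z) \<in> R" using step by (auto simp: R_def padj_def anc_def)
      with step(3) show ?thesis by (rule rtrancl_into_rtrancl)
    qed (use step in simp)
  qed simp
  from shortest_path[OF this] obtain y m where y: "y 0 = x" "y m = w" "\<And>i. i < m \<Longrightarrow> (y i, y (Suc i)) \<in> R"
    "\<And>i j. Suc i < j \<Longrightarrow> j \<le> m \<Longrightarrow> (y i, y j) \<notin> R" "inj_on y {..m}" by blast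
  have step: "padj E (y i) (y (Suc i))" "anc E (y i) (y (Suc i))" if "i < m" for i
    using y(3)[OF that] by (simp_all add: R_def)
  have "\<not> padj E (y i) (y j)" if "Suc i < j" "j \<le> m" for i j
    using y(4)[OF that] chain_anc[of m E y i j] step(2) that by (simp add: R_def)
  with y step show thesis by (intro that[of y m])
qed

section \<open>Equivalence of two graphs with the same local structure\<close>

text \<open>Adjacency and preorder are parameters so that the same notion covers a graph and a partially
  ordered partition; the witnesses \<open>f 0, \<dots>, f (Suc t)\<close> are the elements of \<open>D\<^sup>(\<^sup>t\<^sup>)\<close>.\<close>
definition excl :: "(nat \<Rightarrow> nat \<Rightarrow> bool) \<Rightarrow> (nat \<Rightarrow> nat \<Rightarrow> bool) \<Rightarrow> (nat \<Rightarrow> nat) \<Rightarrow> nat \<Rightarrow> bool" where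
  "excl adj le f t \<longleftrightarrow> 1 \<le> t \<and> inj_on f {..Suc t} \<and>
     (\<forall>i\<le>t. adj (f i) (f (Suc i))) \<and>
     (\<forall>i j. Suc i < j \<and> j \<le> Suc t \<longrightarrow> \<not> adj (f i) (f j)) \<and>
     (\<forall>i\<in>{1..t}. \<forall>j\<in>{1..t}. le (f i) (f j)) \<and>
     (\<forall>i\<in>{1..t}. \<not> le (f i) (f 0) \<and> \<not> le (f i) (f (Suc t)))"

text \<open>The graphical counterpart of \<open>E\<^sup>(\<^sup>3\<^sup>)\<close>: Richardson's unshielded perfect nonconductors.\<close>
definition perf :: "(nat \<times> nat) set \<Rightarrow> nat \<Rightarrow> nat \<Rightarrow> nat \<Rightarrow> bool" where
  "perf E u d v \<longleftrightarrow> u \<noteq> v \<and> \<not> padj E u v \<and> padj E u d \<and> padj E v d \<and>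
     (\<exists>c. (u, c) \<in> E \<and> (v, c) \<in> E \<and> anc E c d)"

text \<open>Otherwise the common child would be an ancestor of \<open>u\<close> or \<open>v\<close>
  and make them p-adjacent.\<close>

lemma perf_not_anc:
  assumes "perf E u d v" shows "\<not> anc E d u" "\<not> anc E d v"
  using assms unfolding perf_def padj_def by (meson anc_trans)+

lemma perf_anc:
  assumes "perf E u d v" shows "anc E u d" "anc E v d"
  using assms unfolding perf_def by (meson anc_trans anc_edge)+

lemma padj_moral:
  assumes "padj E x y" "x \<in> anset E T - Z" "y \<in> anset E T - Z"
  shows "(x, y) \<in> moral E T Z"
  using assms anset_closed[of E _ x T] anset_closed[of E _ y T] unfolding moral_def padj_def by blast

lemma perf_moral:
  assumes "perf E x c y" "c \<in> anset E T" "x \<in> anset E T - Z" "y \<in> anset E T - Z"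
  shows "(x, y) \<in> moral E T Z"
  using assms anset_closed[of E _ c T] unfolding moral_def perf_def by blast

lemma excl_exit:
  assumes "excl adj le f t"
  shows "\<not> le (f 1) (f 0)" "\<not> le (f 1) (f (Suc t))"
  using assms unfolding excl_def by auto

text \<open>Turns a run found by \<open>anc_sink_run\<close> into an \<open>excl\<close> witness:
  the neighbours \<open>k - 1\<close> and \<open>Suc l\<close> become the endpoints, and
  \<open>Suc l - k\<close> is the length of the run. \<open>adj\<close> and \<open>le\<close> are
  independent because adjacency may come from one graph and ancestry from the other.\<close>

lemma excl_run:
  assumes "0 < k" "k \<le> l" "Suc l \<le> p" "inj_on f {..p}"
    and "\<And>i. k - 1 \<le> i \<Longrightarrow> i \<le> l \<Longrightarrow> adj (f i) (f (Suc i))"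
    and "\<And>i j. Suc i < j \<Longrightarrow> j \<le> p \<Longrightarrow> \<not> adj (f i) (f j)"
    and "\<And>i j. i \<in> {k..l} \<Longrightarrow> j \<in> {k..l} \<Longrightarrow> le (f i) (f j)"
    and "\<And>i. i \<in> {k..l} \<Longrightarrow> \<not> le (f i) (f (Suc l))"
    and "\<And>i. i \<in> {k..l} \<Longrightarrow> \<not> le (f i) (f (k - 1))"
  shows "excl adj le (\<lambda>i. f (k - 1 + i)) (Suc l - k)"
proof -
  obtain k0 where k: "k = Suc k0" using assms(1) by (cases k) auto
  have l: "k0 + Suc (l - k0) = Suc l" "1 \<le> l - k0" using assms(2) k by auto
  have r: "k0 + i \<in> {k..l}" if "i \<in> {1..l - k0}" for i using that k l by auto
  have "inj_on (\<lambda>i. f (k0 + i)) {..Suc (l - k0)}"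
    using l assms(3) by (intro inj_onI) (auto dest!: inj_onD[OF assms(4)])
  moreover have "adj (f (k0 + i)) (f (k0 + Suc i))" if "i \<le> l - k0" for i
    using assms(5)[of "k0 + i"] that l k by simp
  moreover have "\<not> adj (f (k0 + i)) (f (k0 + j))" if "Suc i < j" "j \<le> Suc (l - k0)" for i j
    using assms(6)[of "k0 + i" "k0 + j"] that l assms(3) by simp
  moreover have "\<not> le (f (k0 + i)) (f (k0 + 0))" "\<not> le (f (k0 + i)) (f (k0 + Suc (l - k0)))"
    if "i \<in> {1..l - k0}" for i
    using assms(8,9)[OF r[OF that]] l k by simp_all
  ultimately have "excl adj le (\<lambda>i. f (k0 + i)) (l - k0)"
    using l(2) assms(7)[OF r r] unfolding excl_def by blast
  then show ?thesis using k by simp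
qed

text \<open>The assumptions mirror \<open>E1\<close>, \<open>D\<close>, \<open>E3\<close> and
  \<open>E6\<close>; the triples outside \<open>E2\<close> are the case \<open>t = 1\<close> of
  \<open>same_excl\<close>. Only \<open>imperfect_anc\<close> is one-sided, so the locale transfers
  d-connection from \<open>G1\<close> to \<open>G2\<close>; the converse comes from exchanging the
  graphs.\<close>

locale similar_pair =
  fixes G1 G2 :: "(nat \<times> nat) set"
  assumes same_padj: "padj G1 = padj G2"
    and same_excl: "excl (padj G1) (anc G1) f t \<longleftrightarrow> excl (padj G2) (anc G2) f t"
    and same_perf: "perf G1 = perf G2"
    and imperfect_anc: "excl (padj G1) (anc G1) f t \<Longrightarrow> padj G1 (f 0) y \<Longrightarrow> padj G1 (f (Suc t)) y \<Longrightarrow>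
      \<not> perf G1 (f 0) y (f (Suc t)) \<Longrightarrow> \<not> anc G1 y (f 0) \<Longrightarrow> \<not> anc G1 y (f (Suc t)) \<Longrightarrow>
      anc G1 (f 1) y \<Longrightarrow> anc G2 (f 1) y"
begin

text \<open>The triple \<open>u\<close>, \<open>y\<close>, \<open>v\<close> is an
  \<open>excl\<close> witness with a run of length 1.\<close>

lemma same_nonconductor:
  assumes "u \<noteq> v" "\<not> padj G1 u v" "padj G1 u y" "padj G1 v y" "\<not> anc G1 y u" "\<not> anc G1 y v"
  shows "\<not> anc G2 y u" "\<not> anc G2 y v"
proof -
  define f where "f i = (if i = 0 then u else if i = 1 then y else v)" for i :: nat
  have "y \<noteq> u" "y \<noteq> v" using assms by (auto simp: padj_def)
  then have "inj_on f {..Suc 1}" using assms(1) by (auto simp: f_def inj_on_def)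
  moreover have "\<not> padj G1 (f i) (f j)" if "Suc i < j" "j \<le> Suc 1" for i j
    using that assms(2) by (auto simp: f_def)
  ultimately have "excl (padj G1) (anc G1) f 1"
    using assms padj_sym unfolding excl_def by (auto simp: f_def le_Suc_eq)
  then have "excl (padj G2) (anc G2) f 1" using same_excl by simp
  then show "\<not> anc G2 y u" "\<not> anc G2 y v" unfolding excl_def by (auto simp: f_def)
qed

text \<open>A shortest connection has its interior in \<open>W\<close> and is an \<open>excl\<close>
  witness for \<open>G2\<close>. By \<open>same_excl\<close> it is one for \<open>G1\<close>, where
  its first interior vertex does not reach \<open>z\<close>.\<close>

lemma no_common_exit:
  assumes conn: "(u, z) \<in> {(x, y). padj G1 x y \<and> x \<in> W \<union> {u, z} \<and> y \<in> W \<union> {u, z}}\<^sup>*"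
    and uz: "u \<noteq> z" "\<not> padj G1 u z"
    and W: "\<And>x y. x \<in> W \<Longrightarrow> y \<in> W \<Longrightarrow> anc G2 x y"
      "\<And>x. x \<in> W \<Longrightarrow> \<not> anc G2 x u" "\<And>x. x \<in> W \<Longrightarrow> \<not> anc G2 x z"
  shows "\<exists>x\<in>W. \<not> anc G1 x z"
proof -
  define R where "R = {(x, y). padj G1 x y \<and> x \<in> W \<union> {u, z} \<and> y \<in> W \<union> {u, z}}"
  from shortest_path[OF conn[folded R_def]] obtain f m where f: "f 0 = u" "f m = z"
    "\<And>i. i < m \<Longrightarrow> (f i, f (Suc i)) \<in> R"
    "\<And>i j. Suc i < j \<Longrightarrow> j \<le> m \<Longrightarrow> (f i, f j) \<notin> R" "inj_on f {..m}" by blast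
  have adj: "padj G1 (f i) (f (Suc i))" if "i < m" for i using f(3)[OF that] by (simp add: R_def)
  have in': "f i \<in> W \<union> {u, z}" if "i \<le> m" for i
    using f(1,2) f(3)[of i] that by (cases "i = m") (auto simp: R_def)
  have "m \<noteq> 0" using f(1,2) uz by (cases m) auto
  moreover have "m \<noteq> 1" using f(1,2) adj[of 0] uz by auto
  ultimately have m: "m \<ge> 2" by simp
  have W': "f i \<in> W" if "1 \<le> i" "i \<le> m - 1" for i
  proof -
    have i: "i \<le> m" "i \<noteq> 0" "i \<noteq> m" using that m by auto
    then have "f i \<noteq> f 0" "f i \<noteq> f m" using inj_onD[OF f(5), of i 0] inj_onD[OF f(5), of i m] by auto
    then show ?thesis using in'[OF i(1)] f(1,2) by auto
  qed
  define t where "t = m - 1"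
  have t: "m = Suc t" "1 \<le> t" using m by (auto simp: t_def)
  have unc: "\<not> padj G1 (f i) (f j)" if "Suc i < j" "j \<le> Suc t" for i j
    using f(4)[of i j] in'[of i] in'[of j] that t by (auto simp: R_def)
  have W'': "f i \<in> W" if "i \<in> {1..t}" for i using W'[of i] that t by auto
  have "excl (padj G2) (anc G2) f t"
    unfolding excl_def same_padj[symmetric]
  proof (intro conjI allI ballI impI)
    show "inj_on f {..Suc t}" using f(5) t by simp
    show "padj G1 (f i) (f (Suc i))" if "i \<le> t" for i using adj that t by simp
    show "\<not> padj G1 (f i) (f j)" if "Suc i < j \<and> j \<le> Suc t" for i j using unc that by blast
    show "anc G2 (f i) (f j)" if "i \<in> {1..t}" "j \<in> {1..t}" for i j using W(1) W'' that by blast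
    show "\<not> anc G2 (f i) (f 0)" if "i \<in> {1..t}" for i using W(2) W''[OF that] f(1) by simp
    show "\<not> anc G2 (f i) (f (Suc t))" if "i \<in> {1..t}" for i using W(3) W''[OF that] f(2) t by simp
  qed (use t in simp)
  then have "excl (padj G1) (anc G1) f t" using same_excl by simp
  from excl_exit(2)[OF this] have "\<not> anc G1 (f 1) z" using t f(2) by simp
  then show ?thesis using W'[of 1] t by auto
qed

text \<open>A sink strongly connected component (in \<open>G2\<close>) of the part of the path that does not reach
  \<open>T\<close> could be left in \<open>G1\<close> but not in \<open>G2\<close>.\<close>
lemma ancestral_path_transfer:
  fixes y :: "nat \<Rightarrow> nat" and m :: nat
  assumes path: "\<And>i. i < m \<Longrightarrow> padj G1 (y i) (y (Suc i))" "\<And>i. i < m \<Longrightarrow> anc G1 (y i) (y (Suc i))"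
    and unc: "\<And>i j. Suc i < j \<Longrightarrow> j \<le> m \<Longrightarrow> \<not> padj G1 (y i) (y j)" and inj: "inj_on y {..m}"
    and T: "y m \<in> T"
    and R: "\<And>x x'. x \<in> R \<Longrightarrow> x' \<in> R \<Longrightarrow> anc G2 x x'" "y 0 \<in> R" "\<And>x. x \<in> R \<Longrightarrow> anc G1 x (y 0)"
    and S: "\<And>s. s \<in> S \<Longrightarrow> (s, y 0) \<in> {(x, x'). padj G1 x x' \<and> x \<in> R \<union> {s} \<and> x' \<in> R \<union> {s}}\<^sup>*"
      "\<And>s x. s \<in> S \<Longrightarrow> x \<in> R \<Longrightarrow> \<not> anc G2 x s" "\<And>s. s \<in> S \<Longrightarrow> \<not> anc G1 (y 0) s"
    and chord: "\<And>j. 1 \<le> j \<Longrightarrow> j \<le> m \<Longrightarrow> \<exists>s\<in>S. \<not> padj G1 s (y j)"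
  shows "y 0 \<in> anset G2 T"
proof (rule ccontr)
  assume no: "y 0 \<notin> anset G2 T"
  have ym: "y m \<in> anset G2 T" using T anset_self by blast
  obtain k l where kl: "k \<le> l" "l < m" "\<And>i. i \<in> {k..l} \<Longrightarrow> y i \<notin> anset G2 T"
    "\<And>i j. i \<in> {k..l} \<Longrightarrow> j \<in> {k..l} \<Longrightarrow> anc G2 (y i) (y j)"
    "\<And>i. i \<in> {k..l} \<Longrightarrow> \<not> anc G2 (y i) (y (Suc l))"
    "\<And>i. i \<in> {k..l} \<Longrightarrow> k > 0 \<Longrightarrow> \<not> anc G2 (y i) (y (k - 1))"
    by (rule anc_sink_run[where f = y, OF ym le0 no]) (rule that)
  have anc1: "anc G1 (y i) (y j)" if "i \<le> j" "j \<le> m" for i j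
    by (rule chain_anc[where m = m and E = G1 and y = y, OF path(2) that])
  show False
  proof (cases "k = 0")
    case False
    then have "excl (padj G1) (anc G2) (\<lambda>i. y (k - 1 + i)) (Suc l - k)"
      using kl(2) by (intro excl_run[where p = m] kl inj path(1) unc) simp_all
    then have "excl (padj G1) (anc G1) (\<lambda>i. y (k - 1 + i)) (Suc l - k)"
      using same_excl same_padj by simp
    then have "\<not> anc G1 (y (k - 1 + 1)) (y (k - 1 + Suc (Suc l - k)))"
      by (rule excl_exit(2))
    moreover have "k - 1 + 1 = k" "k - 1 + Suc (Suc l - k) = Suc l" using False kl(1) by auto
    ultimately show False using anc1[of k "Suc l"] kl(1,2) by simp
  next
    case True
    \<comment> \<open>The run starts at \<open>y 0\<close> and has no predecessor on the path. Some
      \<open>s\<close> in \<open>S\<close> that is not p-adjacent to the exit \<open>z\<close> takes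
      its place, and \<open>R\<close> links \<open>s\<close> to the run.\<close>
    define z where "z = y (Suc l)"
    obtain s where s: "s \<in> S" "\<not> padj G1 s z" using chord[of "Suc l"] kl(2) by (auto simp: z_def)
    define W where "W = R \<union> y ` {0..l}"
    define Q where "Q = {(x, x'). padj G1 x x' \<and> x \<in> W \<union> {s, z} \<and> x' \<in> W \<union> {s, z}}"
    have "{(x, x'). padj G1 x x' \<and> x \<in> R \<union> {s} \<and> x' \<in> R \<union> {s}} \<subseteq> Q" by (auto simp: Q_def W_def)
    then have "(s, y 0) \<in> Q\<^sup>*" using S(1)[OF s(1)] rtrancl_mono by blast
    moreover have "(y 0, y i) \<in> Q\<^sup>*" if "i \<le> Suc l" for i
      using that
    proof (induction i)
      case (Suc i)
      have "y i \<in> W" using Suc.prems by (auto simp: W_def)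
      moreover have "y (Suc i) \<in> W \<union> {s, z}"
        using Suc.prems by (cases "i = l") (auto simp: W_def z_def)
      ultimately have "(y i, y (Suc i)) \<in> Q" using path(1)[of i] kl(2) Suc.prems by (simp add: Q_def)
      with Suc show ?case by (auto intro: rtrancl_into_rtrancl)
    qed simp
    from this[of "Suc l"] have "(y 0, z) \<in> Q\<^sup>*" by (simp add: z_def)
    ultimately have conn: "(s, z) \<in> Q\<^sup>*" by (rule rtrancl_trans)
    have eq0: "anc G2 x (y 0)" "anc G2 (y 0) x" if "x \<in> W" for x
      using that kl(4)[of _ 0] kl(4)[of 0] R True by (auto simp: W_def)
    have "s \<noteq> z" using S(3)[OF s(1)] anc1[of 0 "Suc l"] kl(2) by (auto simp: z_def)
    moreover have "anc G2 x x'" if "x \<in> W" "x' \<in> W" for x x'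
      by (rule anc_trans[OF eq0(1)[OF that(1)] eq0(2)[OF that(2)]])
    moreover have "\<not> anc G2 x s" if "x \<in> W" for x
      using S(2)[OF s(1) R(2)] anc_trans[OF eq0(2)[OF that]] by blast
    moreover have "\<not> anc G2 x z" if "x \<in> W" for x
      using kl(5)[of 0] anc_trans[OF eq0(2)[OF that]] True unfolding z_def by auto
    ultimately obtain x where x: "x \<in> W" "\<not> anc G1 x z"
      using no_common_exit[OF conn[unfolded Q_def]] s(2) by blast
    have "anc G1 x z"
    proof (cases "x \<in> R")
      case True
      have "anc G1 (y 0) z" using anc1[of 0 "Suc l"] kl(2) by (simp add: z_def)
      then show ?thesis by (rule anc_trans[OF R(3)[OF True]])
    next
      case False
      then obtain i where "x = y i" "i \<le> l" using x(1) by (auto simp: W_def)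
      then show ?thesis using anc1[of i "Suc l"] kl(2) by (simp add: z_def)
    qed
    with x(2) show False by blast
  qed
qed

text \<open>Beyond \<open>y j\<close> every vertex of the path misses \<open>u\<close> or
  \<open>v\<close>, which is the premise \<open>chord\<close> of
  \<open>ancestral_path_transfer\<close> for \<open>R = {y j}\<close> and
  \<open>S = {u, v}\<close>.\<close>

lemma last_common_neighbour:
  fixes y :: "nat \<Rightarrow> nat" and m :: nat
  assumes path: "\<And>i. i < m \<Longrightarrow> padj G1 (y i) (y (Suc i))" "\<And>i. i < m \<Longrightarrow> anc G1 (y i) (y (Suc i))"
    and unc: "\<And>i j. Suc i < j \<Longrightarrow> j \<le> m \<Longrightarrow> \<not> padj G1 (y i) (y j)" and inj: "inj_on y {..m}"
    and T: "y m \<in> T"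
    and uv: "u \<noteq> v" "\<not> padj G1 u v"
    and j: "j \<le> m" "padj G1 u (y j)" "padj G1 v (y j)" "\<not> anc G1 (y j) u" "\<not> anc G1 (y j) v"
    and last: "\<And>i. j < i \<Longrightarrow> i \<le> m \<Longrightarrow> \<not> (padj G1 u (y i) \<and> padj G1 v (y i))"
  shows "y j \<in> anset G2 T"
proof -
  have "(\<lambda>i. y (j + i)) 0 \<in> anset G2 T"
  proof (rule ancestral_path_transfer[where m = "m - j" and R = "{y j}" and S = "{u, v}"])
    show "inj_on (\<lambda>i. y (j + i)) {..m - j}" using j(1) by (intro inj_onI) (auto dest!: inj_onD[OF inj])
    show "padj G1 (y (j + i)) (y (j + Suc i))" "anc G1 (y (j + i)) (y (j + Suc i))" if "i < m - j" for i
      using path[of "j + i"] that by simp_all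
    show "\<not> padj G1 (y (j + i)) (y (j + i'))" if "Suc i < i'" "i' \<le> m - j" for i i'
      using unc[of "j + i" "j + i'"] that j(1) by simp
    show "\<not> anc G2 x s" if "s \<in> {u, v}" "x \<in> {y j}" for s x
      using that same_nonconductor[OF uv j(2-5)] by auto
    show "(s, y (j + 0)) \<in> {(x, x'). padj G1 x x' \<and> x \<in> {y j} \<union> {s} \<and> x' \<in> {y j} \<union> {s}}\<^sup>*"
      if "s \<in> {u, v}" for s
      using that j by (intro r_into_rtrancl) auto
    show "\<exists>s\<in>{u, v}. \<not> padj G1 s (y (j + i))" if "1 \<le> i" "i \<le> m - j" for i
      using last[of "j + i"] that j(1) by auto
  qed (use T j in auto)
  then show ?thesis by simp
qed

text \<open>\<open>d\<close> itself may fail to reach \<open>T\<close> in \<open>G2\<close>.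
  Perfection is inherited by those descendants of \<open>d\<close> that are p-adjacent to both
  \<open>u\<close> and \<open>v\<close>, so the last such vertex on an ancestral path from
  \<open>d\<close> to \<open>T\<close> replaces it.\<close>

lemma perf_transfer:
  assumes p: "perf G1 u d v" and d: "d \<in> anset G1 T"
  obtains d' where "d' \<in> anset G2 T" "perf G2 u d' v"
proof -
  obtain w where w: "w \<in> T" "anc G1 d w" using d by (auto simp: anset_def)
  obtain y m where y: "y 0 = d" "y m = w"
    "\<And>i. i < m \<Longrightarrow> padj G1 (y i) (y (Suc i))" "\<And>i. i < m \<Longrightarrow> anc G1 (y i) (y (Suc i))"
    "\<And>i j. Suc i < j \<Longrightarrow> j \<le> m \<Longrightarrow> \<not> padj G1 (y i) (y j)" "inj_on y {..m}"
    using uncovered_ancestral_path[OF w(2)] by blast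
  define J where "J = {j. j \<le> m \<and> padj G1 u (y j) \<and> padj G1 v (y j)}"
  have fJ: "finite J" and J0: "0 \<in> J" using p y(1) by (auto simp: J_def perf_def)
  define j where "j = Max J"
  have "j \<in> J" unfolding j_def using fJ J0 by (intro Max_in) auto
  then have j: "j \<le> m" "padj G1 u (y j)" "padj G1 v (y j)" by (auto simp: J_def)
  have last: "\<not> (padj G1 u (y i) \<and> padj G1 v (y i))" if "j < i" "i \<le> m" for i
    using Max_ge[OF fJ, of i] that unfolding j_def[symmetric] by (auto simp: J_def)
  have "anc G1 d (y j)" using chain_anc[where m = m and E = G1 and y = y, OF y(4), of 0 j] y(1) j(1) by simp
  then have p': "perf G1 u (y j) v" using p j unfolding perf_def by (meson anc_trans)
  have uv: "u \<noteq> v" "\<not> padj G1 u v" using p by (auto simp: perf_def)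
  have "y m \<in> T" using y(2) w(1) by simp
  from last_common_neighbour[OF y(3,4,5,6) this uv j perf_not_anc[OF p'] last]
  show thesis using that p' same_perf by simp
qed

text \<open>If no later vertex of an ancestral path from \<open>f 1\<close> to \<open>T\<close> is
  p-adjacent to both endpoints, \<open>ancestral_path_transfer\<close> applies with the whole run as
  \<open>R\<close>. Otherwise the last such vertex reaches \<open>T\<close> in \<open>G2\<close>,
  and as it is imperfect, \<open>imperfect_anc\<close> leads from \<open>f 1\<close> to it.\<close>

lemma run_transfer:
  assumes ex: "excl (padj G1) (anc G1) f t" and T: "f 1 \<in> anset G1 T"
    and noperf: "\<And>y. y \<in> anset G1 T \<Longrightarrow> \<not> perf G1 (f 0) y (f (Suc t))"
  shows "f 1 \<in> anset G2 T"
proof -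
  obtain w where w: "w \<in> T" "anc G1 (f 1) w" using T by (auto simp: anset_def)
  obtain y m where y: "y 0 = f 1" "y m = w"
    "\<And>i. i < m \<Longrightarrow> padj G1 (y i) (y (Suc i))" "\<And>i. i < m \<Longrightarrow> anc G1 (y i) (y (Suc i))"
    "\<And>i j. Suc i < j \<Longrightarrow> j \<le> m \<Longrightarrow> \<not> padj G1 (y i) (y j)" "inj_on y {..m}"
    using uncovered_ancestral_path[OF w(2)] by blast
  have ym: "y m \<in> T" using y(2) w(1) by simp
  have ex2: "excl (padj G2) (anc G2) f t" using ex same_excl by simp
  define u v where "u = f 0" and "v = f (Suc t)"
  have t: "1 \<le> t" and uv: "u \<noteq> v" "\<not> padj G1 u v"
    using ex unfolding excl_def u_def v_def by (auto dest: inj_onD)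
  have anc_y: "anc G1 (y i) (y j)" if "i \<le> j" "j \<le> m" for i j
    by (rule chain_anc[where m = m and E = G1 and y = y, OF y(4) that])
  have n1: "\<not> anc G1 (f 1) u" "\<not> anc G1 (f 1) v" using ex t unfolding excl_def u_def v_def by auto
  \<comment> \<open>Index 0 is left out: for \<open>t = 1\<close> the vertex
    \<open>y 0 = f 1\<close> is p-adjacent to both endpoints itself.\<close>
  define J where "J = {j. 1 \<le> j \<and> j \<le> m \<and> padj G1 u (y j) \<and> padj G1 v (y j)}"
  have fJ: "finite J" by (auto simp: J_def)
  show ?thesis
  proof (cases "J = {}")
    case True
    let ?Q = "\<lambda>s. {(x, x'). padj G1 x x' \<and> x \<in> f ` {1..t} \<union> {s} \<and> x' \<in> f ` {1..t} \<union> {s}}"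
    \<comment> \<open>\<open>v\<close> is p-adjacent to the far end \<open>f t\<close>, so it is
      joined to \<open>f 1\<close> backwards through the run.\<close>
    have "(v, f (Suc t - i)) \<in> (?Q v)\<^sup>*" if "i \<le> t" for i
      using that
    proof (induction i)
      case (Suc i)
      have "padj G1 (f (t - i)) (f (Suc (t - i)))" using ex Suc.prems unfolding excl_def by simp
      moreover have "Suc (t - i) = Suc t - i" "Suc t - Suc i = t - i" using Suc.prems by auto
      moreover have "f (Suc t - i) \<in> f ` {1..t} \<union> {v}" "f (t - i) \<in> f ` {1..t} \<union> {v}"
        using Suc.prems by (cases i; auto simp: v_def)+
      ultimately have "(f (Suc t - i), f (Suc t - Suc i)) \<in> ?Q v" using padj_sym by simp
      with Suc show ?case by (auto intro: rtrancl_into_rtrancl)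
    qed (simp add: v_def)
    from this[of t] have vQ: "(v, f 1) \<in> (?Q v)\<^sup>*" by simp
    have "padj G1 u (f 1)" using ex unfolding excl_def u_def by auto
    then have uQ: "(u, f 1) \<in> (?Q u)\<^sup>*" using t by (intro r_into_rtrancl) auto
    have "y 0 \<in> anset G2 T"
    proof (rule ancestral_path_transfer[where m = m and R = "f ` {1..t}" and S = "{u, v}", OF y(3,4,5,6) ym])
      show "(s, y 0) \<in> (?Q s)\<^sup>*" if "s \<in> {u, v}" for s using that uQ vQ y(1) by auto
      show "\<exists>s\<in>{u, v}. \<not> padj G1 s (y j)" if "1 \<le> j" "j \<le> m" for j
        using that True by (auto simp: J_def)
      show "anc G2 x x'" if "x \<in> f ` {1..t}" "x' \<in> f ` {1..t}" for x x'
        using that ex2 unfolding excl_def by auto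
      show "y 0 \<in> f ` {1..t}" using y(1) t by simp
      show "anc G1 x (y 0)" if "x \<in> f ` {1..t}" for x
        using that ex t y(1) unfolding excl_def by auto
      show "\<not> anc G2 x s" if "s \<in> {u, v}" "x \<in> f ` {1..t}" for s x
        using that ex2 unfolding excl_def u_def v_def by auto
      show "\<not> anc G1 (y 0) s" if "s \<in> {u, v}" for s using that n1 y(1) by auto
    qed
    then show ?thesis using y(1) by simp
  next
    case False
    define j where "j = Max J"
    have "j \<in> J" unfolding j_def using fJ False by (intro Max_in) auto
    then have j: "j \<le> m" "padj G1 u (y j)" "padj G1 v (y j)" by (auto simp: J_def)
    have last: "\<not> (padj G1 u (y i) \<and> padj G1 v (y i))" if "j < i" "i \<le> m" for i
      using Max_ge[OF fJ, of i] that unfolding j_def[symmetric] by (auto simp: J_def)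
    have fj: "anc G1 (f 1) (y j)" using anc_y[of 0 j] j(1) y(1) by simp
    have nj: "\<not> anc G1 (y j) u" "\<not> anc G1 (y j) v" using anc_trans[OF fj] n1 by blast+
    have "y j \<in> anset G1 T" using anc_y[of j m] j(1) ym by (auto simp: anset_def)
    then have "anc G2 (f 1) (y j)"
      using imperfect_anc[OF ex, of "y j"] noperf j nj fj unfolding u_def v_def by blast
    moreover have "y j \<in> anset G2 T"
      using last_common_neighbour[OF y(3,4,5,6) ym uv j nj last] by blast
    ultimately show ?thesis by (rule anset_closed)
  qed
qed

lemma moral_transfer:
  assumes ab: "(a, b) \<in> (moral G1 T Z)\<^sup>*" "a \<in> T" "b \<in> T" "a \<notin> Z" "b \<notin> Z"
  shows "(a, b) \<in> (moral G2 T Z)\<^sup>*"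
proof -
  obtain f and n :: nat where f: "f 0 = a" "f n = b"
    "\<And>i. i < n \<Longrightarrow> (f i, f (Suc i)) \<in> moral G1 T Z"
    "\<And>i j. Suc i < j \<Longrightarrow> j \<le> n \<Longrightarrow> (f i, f j) \<notin> moral G1 T Z" "inj_on f {..n}"
    using shortest_path[OF ab(1)] by blast
  have A1: "f i \<in> anset G1 T - Z" if "i \<le> n" for i
    using f(1,2) f(3)[of i] that ab anset_self[of T G1] by (cases "i = n") (auto simp: moral_def)
  have unc: "\<not> padj G1 (f i) (f j)" if "Suc i < j" "j \<le> n" for i j
    using f(4)[OF that] padj_moral A1[of i] A1[of j] that by auto
  \<comment> \<open>A moral edge that is no p-adjacency is a marriage, and the common child is a
    perfect nonconductor for its parents; \<open>perf_transfer\<close> finds one for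
    \<open>G2\<close>.\<close>
  have married: "\<exists>d\<in>anset G2 T. perf G2 (f i) d (f (Suc i))"
    if i: "i < n" "\<not> padj G1 (f i) (f (Suc i))" for i
  proof -
    have ne: "f i \<noteq> f (Suc i)" using inj_onD[OF f(5), of i "Suc i"] i by auto
    obtain c where c: "c \<in> anset G1 T" "(f i, c) \<in> G1" "(f (Suc i), c) \<in> G1"
      using f(3)[OF i(1)] ne i(2) unfolding moral_def padj_def by auto
    have "f i \<noteq> c" "f (Suc i) \<noteq> c" using c i(2) ne unfolding padj_def by auto
    then have "padj G1 (f i) c" "padj G1 (f (Suc i)) c" using c unfolding padj_def by auto
    then have "perf G1 (f i) c (f (Suc i))" using c ne i unfolding perf_def by auto
    from perf_transfer[OF this c(1)] show ?thesis by blast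
  qed
  have A2: "f i \<in> anset G2 T" if i: "i \<le> n" for i
  proof (rule ccontr)
    assume no: "f i \<notin> anset G2 T"
    have fn: "f n \<in> anset G2 T" using ab f(2) anset_self by blast
    obtain k l where kl: "k \<le> l" "l < n" "\<And>i. i \<in> {k..l} \<Longrightarrow> f i \<notin> anset G2 T"
      "\<And>i j. i \<in> {k..l} \<Longrightarrow> j \<in> {k..l} \<Longrightarrow> anc G2 (f i) (f j)"
      "\<And>i. i \<in> {k..l} \<Longrightarrow> \<not> anc G2 (f i) (f (Suc l))"
      "\<And>i. i \<in> {k..l} \<Longrightarrow> k > 0 \<Longrightarrow> \<not> anc G2 (f i) (f (k - 1))"
      by (rule anc_sink_run[where f = f, OF fn i no]) (rule that)
    have notA2: "f i \<notin> anset G2 T" if "k \<le> i" "i \<le> l" for i using kl(3)[of i] that by simp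
    have k0: "0 < k" using notA2[of 0] kl(1) f(1) ab(2) anset_self[of T G2] by (cases k) auto
    \<comment> \<open>A marriage in the run or at its border would put both partners above a vertex
      of \<open>anset G2 T\<close>, against the choice of the run.\<close>
    have adj: "padj G1 (f i) (f (Suc i))" if i: "k - 1 \<le> i" "i \<le> l" for i
    proof (rule ccontr)
      assume "\<not> ?thesis"
      then obtain d where d: "d \<in> anset G2 T" "perf G2 (f i) d (f (Suc i))" using married[of i] i kl(2) by auto
      have "f i \<in> anset G2 T" "f (Suc i) \<in> anset G2 T"
        using perf_anc[OF d(2)] anset_closed[OF _ d(1)] by blast+
      then show False using notA2[of i] notA2[of "Suc i"] i k0 kl(1) by (cases "k \<le> i") auto
    qed
    let ?g = "\<lambda>i. f (k - 1 + i)" and ?t = "Suc l - k"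
    have "excl (padj G1) (anc G2) ?g ?t"
      using kl(2) k0 by (intro excl_run[where p = n] kl f(5) adj unc) simp_all
    then have ex: "excl (padj G1) (anc G1) ?g ?t" using same_excl same_padj by simp
    have e: "k - 1 + Suc ?t = Suc l" "k - 1 + 1 = k" "k - 1 + 0 = k - 1" using k0 kl(1) by auto
    \<comment> \<open>A perfect nonconductor in \<open>anset G1 T\<close> would marry the two
      neighbours of the run and give a chord of the shortest path.\<close>
    have "\<not> perf G1 (?g 0) y (?g (Suc ?t))" if "y \<in> anset G1 T" for y
      using perf_moral[of G1 "?g 0" y "?g (Suc ?t)" T Z] that f(4)[of "k - 1" "Suc l"] A1[of "k - 1"] A1[of "Suc l"]
        kl(1,2) k0 unfolding e by auto
    from run_transfer[OF ex _ this] have "f k \<in> anset G2 T" using A1[of k] kl(1,2) unfolding e by auto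
    then show False using notA2[of k] kl(1) by simp
  qed
  have step: "(f i, f (Suc i)) \<in> moral G2 T Z" if i: "i < n" for i
  proof (cases "padj G1 (f i) (f (Suc i))")
    case True
    then show ?thesis using padj_moral A1[of i] A1[of "Suc i"] A2[of i] A2[of "Suc i"] i
      by (simp add: same_padj)
  next
    case False
    then obtain d where "d \<in> anset G2 T" "perf G2 (f i) d (f (Suc i))" using married[OF i False] by blast
    then show ?thesis using perf_moral A1[of i] A1[of "Suc i"] A2[of i] A2[of "Suc i"] i by simp
  qed
  have "(f 0, f i) \<in> (moral G2 T Z)\<^sup>*" if "i \<le> n" for i
    using that
  proof (induction i)
    case (Suc i)
    then show ?case using step[of i] by (auto intro: rtrancl_into_rtrancl)
  qed simp
  from this[of n] show ?thesis using f(1,2) by simp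
qed

lemma dconn_transfer:
  assumes "a \<noteq> b" "a \<notin> Z" "b \<notin> Z" "dconn G1 a b Z"
  shows "dconn G2 a b Z"
  using assms moral_transfer[of a b "Z \<union> {a, b}" Z] by (simp add: dconn_iff_moral)

end

section \<open>Partially ordered partitions\<close>

text \<open>On vertices the order of the blocks becomes a preorder comparable with
  \<open>anc\<close>. Outside \<open>{1..n}\<close> the value of \<open>blk\<close> is unspecified,
  hence the range hypotheses below.\<close>

definition ple :: "popart \<Rightarrow> nat \<Rightarrow> nat \<Rightarrow> bool" where
  "ple Q a b \<longleftrightarrow> (blk (fst Q) a, blk (fst Q) b) \<in> snd Q"

definition downset :: "nat \<Rightarrow> popart \<Rightarrow> nat set \<Rightarrow> nat set" where
  "downset n Q A = {x \<in> {1..n}. \<exists>a\<in>A. ple Q x a}"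

lemma blk_eq:
  assumes "is_partition n P" "C \<in> P" "i \<in> C"
  shows "blk P i = C"
  unfolding blk_def using assms unfolding is_partition_def by (intro the_equality) blast+

lemma blk_in:
  assumes "is_partition n P" "i \<in> {1..n}"
  shows "blk P i \<in> P" "i \<in> blk P i"
proof -
  obtain C where "C \<in> P" "i \<in> C" using assms unfolding is_partition_def by blast
  then show "blk P i \<in> P" "i \<in> blk P i" using blk_eq[OF assms(1)] by auto
qed

lemma SS_D:
  assumes "Q \<in> SS n"
  shows "is_partition n (fst Q)" "is_porder_on (fst Q) (snd Q)"
  using assms by (auto simp: SS_def)

lemma ple_refl: "Q \<in> SS n \<Longrightarrow> a \<in> {1..n} \<Longrightarrow> ple Q a a"
  using SS_D[of Q n] blk_in(1) unfolding ple_def is_porder_on_def by blast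

lemma ple_trans: "Q \<in> SS n \<Longrightarrow> ple Q a b \<Longrightarrow> ple Q b c \<Longrightarrow> ple Q a c"
  using SS_D[of Q n] unfolding ple_def is_porder_on_def by blast

lemma blk_eq_iff:
  assumes "Q \<in> SS n" "a \<in> {1..n}"
  shows "blk (fst Q) a = blk (fst Q) b \<longleftrightarrow> ple Q a b \<and> ple Q b a"
proof
  assume "blk (fst Q) a = blk (fst Q) b"
  then show "ple Q a b \<and> ple Q b a" using ple_refl[OF assms] by (simp add: ple_def)
next
  assume "ple Q a b \<and> ple Q b a"
  then show "blk (fst Q) a = blk (fst Q) b"
    using SS_D(2)[OF assms(1)] unfolding ple_def is_porder_on_def by blast
qed

lemma mem_blk_iff:
  assumes "Q \<in> SS n" "a \<in> {1..n}"
  shows "d \<in> blk (fst Q) a \<longleftrightarrow> d \<in> {1..n} \<and> ple Q d a \<and> ple Q a d"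
proof
  assume d: "d \<in> blk (fst Q) a"
  have C: "blk (fst Q) a \<in> fst Q" by (rule blk_in(1)[OF SS_D(1)[OF assms(1)] assms(2)])
  have "d \<in> \<Union> (fst Q)" using C d by blast
  then have "d \<in> {1..n}" using SS_D(1)[OF assms(1)] unfolding is_partition_def by simp
  moreover have "blk (fst Q) d = blk (fst Q) a" by (rule blk_eq[OF SS_D(1)[OF assms(1)] C d])
  ultimately show "d \<in> {1..n} \<and> ple Q d a \<and> ple Q a d" using blk_eq_iff[OF assms(1)] by blast
next
  assume d: "d \<in> {1..n} \<and> ple Q d a \<and> ple Q a d"
  then have "blk (fst Q) d = blk (fst Q) a" using blk_eq_iff[OF assms(1)] by blast
  then show "d \<in> blk (fst Q) a" using blk_in(2)[OF SS_D(1)[OF assms(1)], of d] d by simp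
qed

lemma down_downset:
  assumes "Q \<in> SS n" "A \<subseteq> {1..n}"
  shows "down (fst Q) (snd Q) (blk (fst Q) ` A) = downset n Q A"
proof -
  note P = SS_D(1)[OF assms(1)]
  show ?thesis
  proof (intro subset_antisym subsetI)
    fix x assume "x \<in> down (fst Q) (snd Q) (blk (fst Q) ` A)"
    then obtain C a where C: "C \<in> fst Q" "x \<in> C" "a \<in> A" "(C, blk (fst Q) a) \<in> snd Q"
      unfolding down_def le_max_def by auto
    have "x \<in> {1..n}" using P C(1,2) unfolding is_partition_def by blast
    then show "x \<in> downset n Q A" using C blk_eq[OF P C(1,2)] by (auto simp: downset_def ple_def)
  next
    fix x assume "x \<in> downset n Q A"
    then obtain a where a: "x \<in> {1..n}" "a \<in> A" "(blk (fst Q) x, blk (fst Q) a) \<in> snd Q"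
      unfolding downset_def ple_def by auto
    then show "x \<in> down (fst Q) (snd Q) (blk (fst Q) ` A)"
      using blk_in[OF P a(1)] unfolding down_def le_max_def by auto
  qed
qed

lemma E1_iff:
  assumes "Q \<in> SS n"
  shows "(a, b) \<in> E1 n Gs Q \<longleftrightarrow> a \<in> {1..n} \<and> b \<in> {1..n} \<and> a \<noteq> b \<and>
    dconn Gs a b (downset n Q {a, b} - {a, b})"
  using down_downset[OF assms, of "{a, b}"] unfolding E1_def by (auto simp: split_beta dsep_def)

lemma E2_iff:
  "(a, b, c) \<in> E2 n Gs Q \<longleftrightarrow> distinct [a, b, c] \<and> (a, b) \<in> E1 n Gs Q \<and> (c, b) \<in> E1 n Gs Q \<and>
     (a, c) \<notin> E1 n Gs Q \<and> (ple Q b a \<or> ple Q b c)"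
  unfolding E2_def by (auto simp: split_beta le_max_def ple_def)

lemma E1_V: "(a, b) \<in> E1 n Gs Q \<Longrightarrow> a \<in> {1..n} \<and> b \<in> {1..n}"
  unfolding E1_def by (auto simp: split_beta)

lemma E3_iff:
  assumes "Q \<in> SS n"
  shows "(a, b, c) \<in> E3 n Gs Q \<longleftrightarrow> distinct [a, b, c] \<and> (a, b) \<in> E1 n Gs Q \<and> (c, b) \<in> E1 n Gs Q \<and>
     (a, c) \<notin> E1 n Gs Q \<and> dconn Gs a c (downset n Q {a, b, c} - {a, c})"
proof -
  have "down (fst Q) (snd Q) {blk (fst Q) a, blk (fst Q) b, blk (fst Q) c} = downset n Q {a, b, c}"
    if "(a, b) \<in> E1 n Gs Q" "(c, b) \<in> E1 n Gs Q"
    using down_downset[OF assms, of "{a, b, c}"] E1_V[OF that(1)] E1_V[OF that(2)] by simp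
  then show ?thesis unfolding E3_def by (auto simp: split_beta dsep_def)
qed

lemma E4_iff:
  "((a, b1, c), (a', b2, c')) \<in> E4 n Gs Q \<longleftrightarrow> a' = a \<and> c' = c \<and> distinct [a, b1, c] \<and> distinct [a, b2, c] \<and>
        (a, b1) \<in> E1 n Gs Q \<and> (c, b1) \<in> E1 n Gs Q \<and>
        (a, b2) \<in> E1 n Gs Q \<and> (c, b2) \<in> E1 n Gs Q \<and> (a, c) \<notin> E1 n Gs Q \<and>
        (a, b1, c) \<notin> E2 n Gs Q \<union> E3 n Gs Q \<and> (a, b2, c) \<notin> E2 n Gs Q \<union> E3 n Gs Q \<and> ple Q b1 b2"
  unfolding E4_def by (auto simp: split_beta ple_def)

lemma D_length: "xs \<in> D n Gs t Q \<Longrightarrow> length xs = t + 2"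
  unfolding D_def by (auto simp: split_beta)

lemma D_V:
  assumes "xs \<in> D n Gs t Q" shows "set xs \<subseteq> {1..n}"
proof
  fix x assume "x \<in> set xs"
  then obtain i where i: "i < t + 2" "x = xs ! i" using D_length[OF assms] by (auto simp: in_set_conv_nth)
  have e: "(xs ! i, xs ! (i + 1)) \<in> E1 n Gs Q" if "i \<le> t" for i
    using assms that unfolding D_def by (auto simp: split_beta)
  show "x \<in> {1..n}"
  proof (cases "i = t + 1")
    case True then show ?thesis using E1_V[OF e[of t]] i by simp
  next
    case False then show ?thesis using E1_V[OF e[of i]] i by simp
  qed
qed

text \<open>\<open>D\<close> compares the run only with \<open>xs ! 1\<close> and reads
  non-adjacency from later to earlier entries. Members of one block have the same \<open>ple\<close>
  relations and p-adjacency is symmetric, which gives the symmetric form of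
  \<open>excl\<close>.\<close>

lemma D_iff_excl:
  assumes Q: "Q \<in> SS n" and E1: "\<And>a b. (a, b) \<in> E1 n Gs Q \<longleftrightarrow> padj Gs a b" and t: "1 \<le> t"
  shows "xs \<in> D n Gs t Q \<longleftrightarrow> length xs = t + 2 \<and> excl (padj Gs) (ple Q) (\<lambda>i. xs ! i) t"
proof -
  have V: "xs ! i \<in> {1..n}" if "\<forall>i\<le>t. padj Gs (xs ! i) (xs ! Suc i)" "i \<in> {1..t}" for i
    using that E1_V[of "xs ! i" "xs ! Suc i" n Gs Q] E1 by auto
  define B where "B \<longleftrightarrow> (\<forall>i\<in>{1..t}. blk (fst Q) (xs ! i) = blk (fst Q) (xs ! 1)) \<and>
      \<not> le_max (snd Q) (blk (fst Q) (xs ! 1)) {blk (fst Q) (xs ! 0), blk (fst Q) (xs ! (t + 1))}"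
  define B' where "B' \<longleftrightarrow> (\<forall>i\<in>{1..t}. \<forall>j\<in>{1..t}. ple Q (xs ! i) (xs ! j)) \<and>
      (\<forall>i\<in>{1..t}. \<not> ple Q (xs ! i) (xs ! 0) \<and> \<not> ple Q (xs ! i) (xs ! Suc t))"
  define U where "U \<longleftrightarrow> (\<forall>i\<in>{2..t + 1}. \<forall>j\<le>i - 2. (xs ! i, xs ! j) \<notin> E1 n Gs Q)"
  define U' where "U' \<longleftrightarrow> (\<forall>i j. Suc i < j \<and> j \<le> Suc t \<longrightarrow> \<not> padj Gs (xs ! i) (xs ! j))"
  define P where "P \<longleftrightarrow> (\<forall>i\<le>t. padj Gs (xs ! i) (xs ! Suc i))"
  \<comment> \<open>\<open>P\<close> places the run inside \<open>{1..n}\<close>, where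
    \<open>blk_eq_iff\<close> applies.\<close>
  have BB: "B \<longleftrightarrow> B'" if p: P
  proof
    assume L: B
    have eq: "blk (fst Q) (xs ! i) = blk (fst Q) (xs ! 1)" if "i \<in> {1..t}" for i
      using L that unfolding B_def by blast
    have le: "ple Q (xs ! i) z \<longleftrightarrow> ple Q (xs ! 1) z" if "i \<in> {1..t}" for i z
      using eq[OF that] by (simp add: ple_def)
    have ge: "ple Q (xs ! 1) (xs ! j)" if "j \<in> {1..t}" for j
      using blk_eq_iff[OF Q V[OF p[unfolded P_def] that], of "xs ! 1"] eq[OF that] by simp
    have "\<not> ple Q (xs ! 1) (xs ! 0)" "\<not> ple Q (xs ! 1) (xs ! Suc t)"
      using L unfolding B_def le_max_def ple_def by auto
    then have "\<not> ple Q (xs ! i) (xs ! 0) \<and> \<not> ple Q (xs ! i) (xs ! Suc t)" if "i \<in> {1..t}" for i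
      using le[OF that] by simp
    moreover have "ple Q (xs ! i) (xs ! j)" if "i \<in> {1..t}" "j \<in> {1..t}" for i j
      using le[OF that(1)] ge[OF that(2)] by simp
    ultimately show B' unfolding B'_def by simp
  next
    assume R: B'
    have one: "1 \<in> {1..t}" using t by simp
    have "\<forall>i\<in>{1..t}. blk (fst Q) (xs ! i) = blk (fst Q) (xs ! 1)"
    proof
      fix i assume that: "i \<in> {1..t}"
      have "ple Q (xs ! i) (xs ! 1)" "ple Q (xs ! 1) (xs ! i)" using R one that unfolding B'_def by blast+
      then show "blk (fst Q) (xs ! i) = blk (fst Q) (xs ! 1)"
        using blk_eq_iff[OF Q V[OF p[unfolded P_def] that], of "xs ! 1"] by simp
    qed
    moreover have "\<not> ple Q (xs ! 1) (xs ! 0)" "\<not> ple Q (xs ! 1) (xs ! Suc t)"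
      using R one unfolding B'_def by blast+
    then have "\<not> le_max (snd Q) (blk (fst Q) (xs ! 1)) {blk (fst Q) (xs ! 0), blk (fst Q) (xs ! (t + 1))}"
      by (simp add: le_max_def ple_def)
    ultimately show B unfolding B_def by blast
  qed
  have dist: "distinct xs \<longleftrightarrow> inj_on (\<lambda>i. xs ! i) {..Suc t}" if "length xs = t + 2"
    using that by (auto simp: distinct_conv_nth inj_on_def less_Suc_eq_le)
  have UU: "U \<longleftrightarrow> U'"
  proof
    assume L: U
    have "\<not> padj Gs (xs ! i) (xs ! j)" if "Suc i < j" "j \<le> Suc t" for i j
    proof -
      have "j \<in> {2..t + 1}" "i \<le> j - 2" using that by auto
      then show ?thesis using L E1 padj_sym[of Gs "xs ! i"] unfolding U_def by blast
    qed
    then show U' unfolding U'_def by blast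
  next
    assume R: U'
    have "\<not> padj Gs (xs ! i) (xs ! j)" if "i \<in> {2..t + 1}" "j \<le> i - 2" for i j
    proof -
      have "Suc j < i" "i \<le> Suc t" using that by auto
      then show ?thesis using R padj_sym[of Gs "xs ! i"] unfolding U'_def by blast
    qed
    then show U unfolding U_def E1 by blast
  qed
  have "xs \<in> D n Gs t Q \<longleftrightarrow> length xs = t + 2 \<and> distinct xs \<and> P \<and> U \<and> B"
    unfolding D_def P_def U_def B_def by (simp add: split_beta E1)
  also have "\<dots> \<longleftrightarrow> length xs = t + 2 \<and> inj_on (\<lambda>i. xs ! i) {..Suc t} \<and> P \<and> U' \<and> B'"
    using dist UU BB by blast
  also have "\<dots> \<longleftrightarrow> length xs = t + 2 \<and> excl (padj Gs) (ple Q) (\<lambda>i. xs ! i) t"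
    unfolding excl_def P_def U'_def B'_def using t by simp
  finally show ?thesis .
qed

lemma E6_iff:
  "(xs, (a, b, c)) \<in> E6 n Gs Q \<longleftrightarrow> (\<exists>t\<in>{1..n-2}. a = xs ! 0 \<and> c = xs ! (t + 1) \<and>
        distinct [a, b, c] \<and> (a, b) \<in> E1 n Gs Q \<and> (c, b) \<in> E1 n Gs Q \<and>
        (a, b, c) \<notin> E2 n Gs Q \<union> E3 n Gs Q \<and>
        xs \<in> D n Gs t Q \<and> ple Q (xs ! 1) b)"
  unfolding E6_def by (auto simp: split_beta ple_def)

section \<open>Finiteness, and optimal cardinality as equality of sets\<close>

lemma finite_E1: "finite (E1 n Gs Q)"
proof (rule finite_subset)
  show "E1 n Gs Q \<subseteq> {1..n} \<times> {1..n}" by (auto dest: E1_V)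
qed simp

lemma finite_E2: "finite (E2 n Gs Q)"
proof (rule finite_subset)
  show "E2 n Gs Q \<subseteq> {1..n} \<times> {1..n} \<times> {1..n}"
    unfolding E2_def by (auto simp: split_beta dest: E1_V)
qed simp

lemma finite_E3: "finite (E3 n Gs Q)"
proof (rule finite_subset)
  show "E3 n Gs Q \<subseteq> {1..n} \<times> {1..n} \<times> {1..n}"
    unfolding E3_def by (auto simp: split_beta dest: E1_V)
qed simp

lemma finite_E4: "finite (E4 n Gs Q)"
proof (rule finite_subset)
  show "E4 n Gs Q \<subseteq> ({1..n} \<times> {1..n} \<times> {1..n}) \<times> ({1..n} \<times> {1..n} \<times> {1..n})"
    unfolding E4_def by (auto simp: split_beta dest: E1_V)
qed simp

lemma finite_D: "finite (D n Gs t Q)"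
  by (rule finite_subset[OF _ finite_lists_length_eq[of "{1..n}" "t + 2"]]) (use D_V[of _ n Gs t Q] D_length[of _ n Gs t Q] in auto)

lemma finite_E6: "finite (E6 n Gs Q)"
proof (rule finite_subset)
  show "E6 n Gs Q \<subseteq> (\<Union>t\<in>{1..n-2}. D n Gs t Q) \<times> ({1..n} \<times> {1..n} \<times> {1..n})"
    unfolding E6_def by (auto simp: split_beta dest: E1_V)
qed (use finite_D in simp)

text \<open>The set of \<open>q\<close> is contained in all others, so equal cardinality means
  equality. Finiteness matters because \<open>card\<close> of an infinite set is 0.\<close>

lemma argmin_on_card:
  assumes "q \<in> A" "\<And>p. p \<in> A \<Longrightarrow> F q \<subseteq> F p" "\<And>p. finite (F p)"
  shows "argmin_on A (\<lambda>p. card (F p)) = {p \<in> A. F p = F q}"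
proof -
  have "F p = F q" if "p \<in> A" "card (F p) \<le> card (F q)" for p
    using card_subset_eq[OF assms(3) assms(2)[OF that(1)]] card_mono[OF assms(3) assms(2)[OF that(1)]] that(2)
    by simp
  moreover have "card (F q) \<le> card (F p)" if "p \<in> A" for p
    by (rule card_mono[OF assms(3) assms(2)[OF that]])
  ultimately show ?thesis using assms(1) unfolding argmin_on_def by auto
qed

lemma argmax_on_card:
  assumes "q \<in> A" "\<And>p. p \<in> A \<Longrightarrow> F p \<subseteq> F q" "finite (F q)"
  shows "argmax_on A (\<lambda>p. card (F p)) = {p \<in> A. F p = F q}"
proof -
  have "F p = F q" if "p \<in> A" "card (F q) \<le> card (F p)" for p
    using card_subset_eq[OF assms(3) assms(2)[OF that(1)]] card_mono[OF assms(3) assms(2)[OF that(1)]] that(2)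
    by simp
  moreover have "card (F p) \<le> card (F q)" if "p \<in> A" for p
    by (rule card_mono[OF assms(3) assms(2)[OF that]])
  ultimately show ?thesis using assms(1) unfolding argmax_on_def by auto
qed

section \<open>The partially ordered partition of the true graph\<close>

lemma padj_V: "digraph n E \<Longrightarrow> padj E a b \<Longrightarrow> a \<in> {1..n} \<and> b \<in> {1..n}"
  unfolding digraph_def padj_def by blast

lemma anc_V: "digraph n E \<Longrightarrow> anc E a b \<Longrightarrow> b \<in> {1..n} \<Longrightarrow> a \<in> {1..n}"
  unfolding anc_def digraph_def by (erule converse_rtranclE) auto

lemma common_child_padj:
  assumes "digraph n E" "(a, c) \<in> E" "(b, c) \<in> E"
  shows "padj E a c" "padj E b c"
  using assms unfolding digraph_def padj_def by auto

lemma scc_class: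
  assumes "C \<in> scc_part n E" "x \<in> C"
  shows "C = {j \<in> {1..n}. anc E x j \<and> anc E j x}"
proof -
  obtain i where i: "C = {j \<in> {1..n}. anc E i j \<and> anc E j i}"
    using assms(1) unfolding scc_part_def by blast
  then have x: "anc E i x" "anc E x i" using assms(2) by auto
  have "anc E i j \<longleftrightarrow> anc E x j" "anc E j i \<longleftrightarrow> anc E j x" for j
    using anc_trans[OF x(1), of j] anc_trans[OF x(2), of j] anc_trans[OF _ x(1), of j]
      anc_trans[OF _ x(2), of j] by blast+
  then show ?thesis using i by simp
qed

lemma scc_order_anc:
  assumes "(C1, C2) \<in> scc_order n E" "x \<in> C1" "y \<in> C2"
  shows "anc E x y"
proof (cases "C1 = C2")
  case True
  then show ?thesis using scc_class[of C1 n E x] assms unfolding scc_order_def by auto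
next
  case False
  then obtain x' y' where "x' \<in> C1" "y' \<in> C2" "anc E x' y'" "C1 \<in> scc_part n E" "C2 \<in> scc_part n E"
    using assms(1) unfolding scc_order_def by auto
  moreover from this have "anc E x x'" "anc E y' y"
    using scc_class[of C1 n E x] scc_class[of C2 n E y] assms(2,3) by auto
  ultimately show ?thesis by (meson anc_trans)
qed

lemma scc_SS: "(scc_part n E, scc_order n E) \<in> SS n"
proof -
  have eq: "C1 = C2"
    if "C1 \<in> scc_part n E" "C2 \<in> scc_part n E" "x \<in> C1" "y \<in> C2" "anc E x y" "anc E y x" for C1 C2 x y
  proof -
    have "y \<in> {1..n}" using scc_class[OF that(2,4)] that(4) by blast
    then have "y \<in> C1" using scc_class[OF that(1,3)] that(5,6) by blast
    then show ?thesis using scc_class[OF that(1), of y] scc_class[OF that(2,4)] by simp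
  qed
  have "is_partition n (scc_part n E)"
    unfolding is_partition_def
  proof (intro conjI ballI impI)
    show "\<Union> (scc_part n E) = {1..n}" unfolding scc_part_def using anc_refl by blast
    show "{} \<notin> scc_part n E" unfolding scc_part_def using anc_refl by blast
    show "C1 \<inter> C2 = {}" if "C1 \<in> scc_part n E" "C2 \<in> scc_part n E" "C1 \<noteq> C2" for C1 C2
      using that(3) eq[OF that(1,2) _ _ anc_refl anc_refl] by blast
  qed
  moreover have "is_porder_on (scc_part n E) (scc_order n E)"
  proof -
    have part: "C1 \<in> scc_part n E" "C2 \<in> scc_part n E" if "(C1, C2) \<in> scc_order n E" for C1 C2
      using that unfolding scc_order_def by auto
    have ne: "\<exists>x. x \<in> C" if "C \<in> scc_part n E" for C
      using that unfolding scc_part_def using anc_refl by blast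
    show ?thesis
      unfolding is_porder_on_def
    proof (intro conjI ballI allI impI)
      show "scc_order n E \<subseteq> scc_part n E \<times> scc_part n E" using part by auto
      show "(C, C) \<in> scc_order n E" if "C \<in> scc_part n E" for C
        using that unfolding scc_order_def by auto
      show "C1 = C2" if h: "(C1, C2) \<in> scc_order n E \<and> (C2, C1) \<in> scc_order n E" for C1 C2
      proof -
        note h1 = h[THEN conjunct1] and h2 = h[THEN conjunct2]
        obtain x where x: "x \<in> C1" using ne[OF part(1)[OF h1]] by blast
        obtain y where y: "y \<in> C2" using ne[OF part(2)[OF h1]] by blast
        show ?thesis
          by (rule eq[OF part[OF h1] x y scc_order_anc[OF h1 x y] scc_order_anc[OF h2 y x]])
      qed
      show "(C1, C3) \<in> scc_order n E"
        if h: "(C1, C2) \<in> scc_order n E \<and> (C2, C3) \<in> scc_order n E" for C1 C2 C3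
      proof -
        note h1 = h[THEN conjunct1] and h2 = h[THEN conjunct2]
        obtain x where x: "x \<in> C1" using ne[OF part(1)[OF h1]] by blast
        obtain y where y: "y \<in> C2" using ne[OF part(2)[OF h1]] by blast
        obtain z where z: "z \<in> C3" using ne[OF part(2)[OF h2]] by blast
        have "anc E x z" by (rule anc_trans[OF scc_order_anc[OF h1 x y] scc_order_anc[OF h2 y z]])
        then show ?thesis using part(1)[OF h1] part(2)[OF h2] x z unfolding scc_order_def by blast
      qed
    qed
  qed
  ultimately show ?thesis unfolding SS_def by simp
qed

lemma scc_ple:
  assumes "a \<in> {1..n}" "b \<in> {1..n}"
  shows "ple (scc_part n E, scc_order n E) a b \<longleftrightarrow> anc E a b"
proof -
  have P: "is_partition n (scc_part n E)" using SS_D(1)[OF scc_SS[of n E]] by simp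
  note a = blk_in[OF P assms(1)] and b = blk_in[OF P assms(2)]
  show ?thesis
  proof
    assume "ple (scc_part n E, scc_order n E) a b"
    then have "(blk (scc_part n E) a, blk (scc_part n E) b) \<in> scc_order n E" by (simp add: ple_def)
    then show "anc E a b" by (rule scc_order_anc[OF _ a(2) b(2)])
  next
    assume "anc E a b"
    then have "(blk (scc_part n E) a, blk (scc_part n E) b) \<in> scc_order n E"
      using a b unfolding scc_order_def by auto
    then show "ple (scc_part n E, scc_order n E) a b" by (simp add: ple_def)
  qed
qed

lemma padj_dconn:
  assumes "padj E a b" "a \<notin> Z" "b \<notin> Z"
  shows "dconn E a b Z"
proof -
  have "a \<noteq> b" using assms(1) by (simp add: padj_def)
  moreover have "a \<in> anset E (Z \<union> {a, b}) - Z" "b \<in> anset E (Z \<union> {a, b}) - Z"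
    using anset_self[of "Z \<union> {a, b}" E] assms by auto
  ultimately show ?thesis
    using dconn_iff_moral[OF _ assms(2,3)] r_into_rtrancl[OF padj_moral[OF assms(1)]] by simp
qed

text \<open>After conditioning on the rest of \<open>anset E W\<close>, only \<open>a\<close> and
  \<open>b\<close> are left in the moral graph, so reachability is a single edge. \<open>W\<close>
  may exceed \<open>{a, b}\<close> for the sake of \<open>E3\<close>.\<close>

lemma dconn_ancestral:
  assumes ab: "a \<noteq> b" "a \<in> W" "b \<in> W" and "dconn E a b (anset E W - {a, b})"
  shows "(a, b) \<in> E \<or> (b, a) \<in> E \<or> (\<exists>c\<in>anset E W. (a, c) \<in> E \<and> (b, c) \<in> E)"
proof -
  define R where "R = moral E (anset E W) (anset E W - {a, b})"
  have AA: "anset E (anset E W) = anset E W"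
    using anset_self[of "anset E W" E] by (auto simp: anset_def intro: anc_trans)
  have "anset E W - {a, b} \<union> {a, b} = anset E W" using ab anset_self[of W E] by auto
  then have "(a, b) \<in> R\<^sup>*"
    using assms(4) dconn_iff_moral[of a b "anset E W - {a, b}" E] ab by (simp add: R_def)
  moreover have "x = a \<or> x = b" if "(x, y) \<in> R" for x y
    using that unfolding R_def moral_def AA by auto
  moreover have "y = a \<or> y = b" if "(x, y) \<in> R" for x y
    using that unfolding R_def moral_def AA by auto
  ultimately have "b = a \<or> (a, b) \<in> R"
    by (induction rule: rtrancl_induct) blast+
  then show ?thesis using ab unfolding R_def moral_def AA by auto
qed

lemma perf_dconn:
  assumes "perf E a b c" "b \<in> Z" "a \<notin> Z" "c \<notin> Z"
  shows "dconn E a c Z"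
proof -
  have "a \<noteq> c" using assms(1) by (simp add: perf_def)
  moreover have "b \<in> anset E (Z \<union> {a, c})" "a \<in> anset E (Z \<union> {a, c}) - Z" "c \<in> anset E (Z \<union> {a, c}) - Z"
    using anset_self[of "Z \<union> {a, c}" E] assms by auto
  ultimately show ?thesis
    using dconn_iff_moral[OF _ assms(3,4)] r_into_rtrancl[OF perf_moral[OF assms(1)]] by simp
qed

lemma path_dconn:
  fixes f :: "nat \<Rightarrow> nat"
  assumes path: "\<And>i. i \<le> t \<Longrightarrow> padj E (f i) (f (Suc i))"
    and mid: "\<And>i. i \<in> {1..t} \<Longrightarrow> f i \<in> anset E (Z \<union> {f 0, f (Suc t)}) - Z"
    and ends: "f 0 \<notin> Z" "f (Suc t) \<notin> Z" "f 0 \<noteq> f (Suc t)"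
  shows "dconn E (f 0) (f (Suc t)) Z"
proof -
  let ?T = "Z \<union> {f 0, f (Suc t)}"
  have A: "f i \<in> anset E ?T - Z" if "i \<le> Suc t" for i
  proof -
    consider "i = 0" | "i = Suc t" | "i \<in> {1..t}" using \<open>i \<le> Suc t\<close> by fastforce
    then show ?thesis
    proof cases
      case 1 then show ?thesis using ends anset_self[of ?T E] by auto
    next
      case 2 then show ?thesis using ends anset_self[of ?T E] by auto
    next
      case 3 then show ?thesis by (rule mid)
    qed
  qed
  have "(f 0, f i) \<in> (moral E ?T Z)\<^sup>*" if "i \<le> Suc t" for i
    using that
  proof (induction i)
    case (Suc i)
    have "(f i, f (Suc i)) \<in> moral E ?T Z"
      using padj_moral[OF path[of i] A[of i] A[of "Suc i"]] Suc.prems by simp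
    with Suc show ?case by (auto intro: rtrancl_into_rtrancl)
  qed simp
  from this[of "Suc t"] show ?thesis using dconn_iff_moral[OF ends(3,1,2)] by simp
qed

lemma excl_cong:
  assumes "\<And>i. i \<le> Suc t \<Longrightarrow> f i = g i"
    and "\<And>i j. i \<le> Suc t \<Longrightarrow> j \<le> Suc t \<Longrightarrow> le (g i) (g j) = le' (g i) (g j)"
  shows "excl adj le f t \<longleftrightarrow> excl adj le' g t"
proof -
  have "inj_on f {..Suc t} \<longleftrightarrow> inj_on g {..Suc t}" by (rule inj_on_cong) (use assms in auto)
  then show ?thesis unfolding excl_def using assms by simp
qed

section \<open>The stages of the minimisation compared with the true graph\<close>

locale true_graph =
  fixes n :: nat and Gs :: "(nat \<times> nat) set"
  assumes n3: "n \<ge> 3" and dg: "digraph n Gs"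
begin

definition Qs :: popart where "Qs = (scc_part n Gs, scc_order n Gs)"

lemma Qs_SS: "Qs \<in> SS n" unfolding Qs_def by (rule scc_SS)

lemma Qs_ple: "a \<in> {1..n} \<Longrightarrow> b \<in> {1..n} \<Longrightarrow> ple Qs a b \<longleftrightarrow> anc Gs a b"
  unfolding Qs_def by (rule scc_ple)

lemma downset_Qs:
  assumes "W \<subseteq> {1..n}" shows "downset n Qs W = anset Gs W"
proof (intro subset_antisym subsetI)
  fix x assume "x \<in> downset n Qs W"
  then obtain w where w: "x \<in> {1..n}" "w \<in> W" "ple Qs x w" unfolding downset_def by auto
  then have "w \<in> {1..n}" using assms by blast
  then show "x \<in> anset Gs W" using Qs_ple[of x w] w unfolding anset_def by blast
next
  fix x assume "x \<in> anset Gs W"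
  then obtain w where w: "w \<in> W" "anc Gs x w" unfolding anset_def by auto
  then have "w \<in> {1..n}" using assms by blast
  moreover from this have "x \<in> {1..n}" by (rule anc_V[OF dg w(2)])
  ultimately show "x \<in> downset n Qs W" using Qs_ple[of x w] w unfolding downset_def by blast
qed

lemma E1_Qs: "(a, b) \<in> E1 n Gs Qs \<longleftrightarrow> padj Gs a b"
proof
  assume "(a, b) \<in> E1 n Gs Qs"
  then have ab: "a \<in> {1..n}" "b \<in> {1..n}" "a \<noteq> b" "dconn Gs a b (downset n Qs {a, b} - {a, b})"
    using E1_iff[OF Qs_SS, of a b Gs] by auto
  from ab(4) have "dconn Gs a b (anset Gs {a, b} - {a, b})" using downset_Qs[of "{a, b}"] ab by simp
  from dconn_ancestral[OF ab(3) _ _ this] show "padj Gs a b"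
    using ab(3) unfolding padj_def anset_def by auto
next
  assume p: "padj Gs a b"
  then show "(a, b) \<in> E1 n Gs Qs"
    using E1_iff[OF Qs_SS, of a b Gs] padj_V[OF dg p] padj_dconn[OF p] by (auto simp: padj_def)
qed

text \<open>p-adjacent vertices are d-connected given any set that avoids them, so no candidate can
  drop them from \<open>E1\<close>.\<close>

lemma S1_eq: "S1 n Gs = {Q \<in> SS n. E1 n Gs Q = E1 n Gs Qs}"
  unfolding S1_def
proof (rule argmin_on_card[OF Qs_SS _ finite_E1])
  fix Q assume Q: "Q \<in> SS n"
  show "E1 n Gs Qs \<subseteq> E1 n Gs Q"
  proof clarify
    fix a b assume "(a, b) \<in> E1 n Gs Qs"
    then have p: "padj Gs a b" by (simp add: E1_Qs)
    then show "(a, b) \<in> E1 n Gs Q"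
      using E1_iff[OF Q, of a b Gs] padj_V[OF dg p] padj_dconn[OF p] by (auto simp: padj_def)
  qed
qed

lemma S1_padj:
  assumes "Q \<in> S1 n Gs"
  shows "Q \<in> SS n" "(a, b) \<in> E1 n Gs Q \<longleftrightarrow> padj Gs a b"
  using assms E1_Qs by (auto simp: S1_eq)

lemma not_padj_dsep:
  assumes "Q \<in> S1 n Gs" "a \<in> {1..n}" "b \<in> {1..n}" "a \<noteq> b" "\<not> padj Gs a b"
  shows "\<not> dconn Gs a b (downset n Q {a, b} - {a, b})"
  using S1_padj[OF assms(1)] E1_iff[of Q n a b Gs] assms by blast

lemma Qs_S1: "Qs \<in> S1 n Gs" using Qs_SS by (simp add: S1_eq)

text \<open>If \<open>b\<close> reaches \<open>a\<close> or \<open>c\<close> in \<open>Gs\<close>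
  without lying below either in \<open>Q\<close>, then \<open>b\<close> is not conditioned on and
  the path \<open>a\<close>, \<open>b\<close>, \<open>c\<close> connects the pair, although the
  candidate separates it.\<close>

lemma S2_eq: "S2 n Gs = {Q \<in> S1 n Gs. E2 n Gs Q = E2 n Gs Qs}"
  unfolding S2_def
proof (rule argmin_on_card[OF Qs_S1 _ finite_E2])
  fix Q assume Q: "Q \<in> S1 n Gs"
  show "E2 n Gs Qs \<subseteq> E2 n Gs Q"
  proof clarify
    fix a b c assume "(a, b, c) \<in> E2 n Gs Qs"
    then have h: "distinct [a, b, c]" "padj Gs a b" "padj Gs c b" "\<not> padj Gs a c" "ple Qs b a \<or> ple Qs b c"
      by (auto simp: E2_iff E1_Qs)
    have V: "a \<in> {1..n}" "b \<in> {1..n}" "c \<in> {1..n}" using padj_V[OF dg h(2)] padj_V[OF dg h(3)] by auto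
    have anc: "anc Gs b a \<or> anc Gs b c" using h(5) Qs_ple V by blast
    have "b \<in> downset n Q {a, c}"
    proof (rule ccontr)
      assume b: "b \<notin> downset n Q {a, c}"
      define Z where "Z = downset n Q {a, c} - {a, c}"
      define f where "f i = (if i = 0 then a else if i = 1 then b else c)" for i :: nat
      have "dconn Gs (f 0) (f (Suc 1)) Z"
      proof (rule path_dconn)
        show "padj Gs (f i) (f (Suc i))" if "i \<le> 1" for i
          using that h(2,3) padj_sym[of Gs b c] by (cases i) (auto simp: f_def)
        show "f i \<in> anset Gs (Z \<union> {f 0, f (Suc 1)}) - Z" if "i \<in> {1..1}" for i
          using that anc b by (auto simp: f_def anset_def Z_def)
      qed (use h(1) in \<open>auto simp: f_def Z_def\<close>)
      then show False using not_padj_dsep[OF Q V(1,3) _ h(4)] h(1) by (simp add: f_def Z_def)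
    qed
    then have "ple Q b a \<or> ple Q b c" by (auto simp: downset_def)
    then show "(a, b, c) \<in> E2 n Gs Q" using h S1_padj(2)[OF Q] by (simp add: E2_iff)
  qed
qed

lemma S2_D:
  assumes "Q \<in> S2 n Gs" shows "Q \<in> S1 n Gs" "E2 n Gs Q = E2 n Gs Qs"
  using assms by (auto simp: S2_eq)

lemma Qs_S2: "Qs \<in> S2 n Gs" using Qs_S1 by (simp add: S2_eq)

lemma E3_S1_iff:
  assumes "Q \<in> S1 n Gs"
  shows "(a, b, c) \<in> E3 n Gs Q \<longleftrightarrow> distinct [a, b, c] \<and> padj Gs a b \<and> padj Gs c b \<and> \<not> padj Gs a c \<and>
    dconn Gs a c (downset n Q {a, b, c} - {a, c})"
  using E3_iff[OF S1_padj(1)[OF assms], of a b c Gs] S1_padj(2)[OF assms] by simp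

text \<open>Conditioning on all other ancestors leaves a common child as the only link. It reaches
  neither \<open>a\<close> nor \<open>c\<close>, which would become p-adjacent, so it reaches
  \<open>b\<close>.\<close>

lemma E3_Qs: "(a, b, c) \<in> E3 n Gs Qs \<longleftrightarrow> perf Gs a b c"
proof
  assume "(a, b, c) \<in> E3 n Gs Qs"
  then have h: "distinct [a, b, c]" "padj Gs a b" "padj Gs c b" "\<not> padj Gs a c"
      "dconn Gs a c (downset n Qs {a, b, c} - {a, c})"
    using E3_S1_iff[OF Qs_S1] by auto
  have V: "a \<in> {1..n}" "b \<in> {1..n}" "c \<in> {1..n}" using padj_V[OF dg h(2)] padj_V[OF dg h(3)] by auto
  have "dconn Gs a c (anset Gs {a, b, c} - {a, c})" using h(5) downset_Qs[of "{a, b, c}"] V by simp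
  from dconn_ancestral[OF _ _ _ this] h(1,4) obtain d where d: "d \<in> anset Gs {a, b, c}" "(a, d) \<in> Gs" "(c, d) \<in> Gs"
    by (auto simp: padj_def)
  have "\<not> anc Gs d a" "\<not> anc Gs d c" using h(1,4) d unfolding padj_def by auto
  then have "anc Gs d b" using d(1) unfolding anset_def by auto
  then show "perf Gs a b c" using h d unfolding perf_def by auto
next
  assume p: "perf Gs a b c"
  then have h: "a \<noteq> c" "padj Gs a b" "padj Gs c b" "\<not> padj Gs a c" unfolding perf_def by auto
  then have abc: "distinct [a, b, c]" by (auto simp: padj_def)
  have V: "b \<in> {1..n}" using padj_V[OF dg h(2)] by auto
  then have "b \<in> downset n Qs {a, b, c} - {a, c}" using ple_refl[OF Qs_SS V] abc by (auto simp: downset_def)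
  then show "(a, b, c) \<in> E3 n Gs Qs" using E3_S1_iff[OF Qs_S1] h abc perf_dconn[OF p] by simp
qed

text \<open>Reflexivity of the order puts \<open>b\<close> into the conditioning set of every
  candidate, so the marriage of \<open>a\<close> and \<open>c\<close> persists.\<close>

lemma S3_eq: "S3 n Gs = {Q \<in> S2 n Gs. E3 n Gs Q = E3 n Gs Qs}"
  unfolding S3_def
proof (rule argmin_on_card[OF Qs_S2 _ finite_E3])
  fix Q assume "Q \<in> S2 n Gs"
  then have Q: "Q \<in> S1 n Gs" by (rule S2_D)
  show "E3 n Gs Qs \<subseteq> E3 n Gs Q"
  proof clarify
    fix a b c assume abc: "(a, b, c) \<in> E3 n Gs Qs"
    then have p: "perf Gs a b c" by (simp add: E3_Qs)
    have h: "distinct [a, b, c]" "padj Gs a b" "padj Gs c b" "\<not> padj Gs a c"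
      using abc E3_S1_iff[OF Qs_S1] by auto
    have V: "b \<in> {1..n}" using padj_V[OF dg h(2)] by auto
    then have "b \<in> downset n Q {a, b, c} - {a, c}"
      using ple_refl[OF S1_padj(1)[OF Q] V] h(1) by (auto simp: downset_def)
    then show "(a, b, c) \<in> E3 n Gs Q" using E3_S1_iff[OF Q] h perf_dconn[OF p] by simp
  qed
qed

lemma S3_D:
  assumes "Q \<in> S3 n Gs"
  shows "Q \<in> S1 n Gs" "E2 n Gs Q = E2 n Gs Qs" "E3 n Gs Q = E3 n Gs Qs"
  using assms S2_D by (auto simp: S3_eq)

lemma Qs_S3: "Qs \<in> S3 n Gs" using Qs_S2 by (simp add: S3_eq)

text \<open>If \<open>f 1\<close> were not below \<open>b\<close>, the run would avoid the
  conditioning set of the triple while reaching \<open>b\<close> inside it; the path would be open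
  and the triple in \<open>E3\<close>. Serves \<open>E4\<close> with \<open>t = 1\<close> and
  \<open>E6\<close> in general.\<close>

lemma run_below_nonconductor:
  assumes Q: "Q \<in> S1 n Gs"
    and path: "\<And>i. i \<le> t \<Longrightarrow> padj Gs (f i) (f (Suc i))" and t: "1 \<le> t"
    and ac: "\<not> padj Gs (f 0) (f (Suc t))" "f 0 \<noteq> f (Suc t)"
    and run: "\<And>i. i \<in> {1..t} \<Longrightarrow> ple Q (f 1) (f i)"
      "\<And>i. i \<in> {1..t} \<Longrightarrow> \<not> ple Q (f i) (f 0) \<and> \<not> ple Q (f i) (f (Suc t))"
    and below: "\<And>i. i \<in> {1..t} \<Longrightarrow> anc Gs (f i) b"
    and b: "padj Gs (f 0) b" "padj Gs (f (Suc t)) b" "(f 0, b, f (Suc t)) \<notin> E3 n Gs Q"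
  shows "ple Q (f 1) b"
proof (rule ccontr)
  assume no: "\<not> ple Q (f 1) b"
  define a c where "a = f 0" and "c = f (Suc t)"
  define Z where "Z = downset n Q {a, b, c} - {a, c}"
  note SS = S1_padj(1)[OF Q]
  have bac: "b \<noteq> a" "b \<noteq> c" using b by (auto simp: padj_def a_def c_def)
  have "b \<in> {1..n}" using padj_V[OF dg b(1)] by auto
  then have bZ: "b \<in> Z" using ple_refl[OF SS, of b] bac by (auto simp: Z_def downset_def)
  have notZ: "f i \<notin> Z" if i: "i \<in> {1..t}" for i
  proof -
    have "\<not> ple Q (f i) b" using ple_trans[OF SS run(1)[OF i], of b] no by blast
    then show ?thesis using run(2)[OF i] by (auto simp: Z_def downset_def a_def c_def)
  qed
  have "dconn Gs (f 0) (f (Suc t)) Z"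
  proof (rule path_dconn[where f = f and t = t, OF path])
    show "f i \<in> anset Gs (Z \<union> {f 0, f (Suc t)}) - Z" if "i \<in> {1..t}" for i
      using below[OF that] bZ notZ[OF that] by (auto simp: anset_def)
  qed (use ac in \<open>auto simp: Z_def a_def c_def\<close>)
  then have "(a, b, c) \<in> E3 n Gs Q"
    using E3_S1_iff[OF Q, of a b c] b ac bac by (simp add: a_def c_def Z_def)
  with b show False by (simp add: a_def c_def)
qed

lemma S4_eq: "S4 n Gs = {Q \<in> S3 n Gs. E4 n Gs Q = E4 n Gs Qs}"
  unfolding S4_def
proof (rule argmin_on_card[OF Qs_S3 _ finite_E4])
  fix Q assume Q: "Q \<in> S3 n Gs"
  note Q1 = S3_D(1)[OF Q]
  show "E4 n Gs Qs \<subseteq> E4 n Gs Q"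
  proof clarify
    fix a b1 c a' b2 c' assume "((a, b1, c), (a', b2, c')) \<in> E4 n Gs Qs"
    then have h: "a' = a" "c' = c" "distinct [a, b1, c]" "distinct [a, b2, c]"
      "padj Gs a b1" "padj Gs c b1" "padj Gs a b2" "padj Gs c b2" "\<not> padj Gs a c"
      "(a, b1, c) \<notin> E2 n Gs Q \<union> E3 n Gs Q" "(a, b2, c) \<notin> E2 n Gs Q \<union> E3 n Gs Q" "ple Qs b1 b2"
      using E4_iff[of a b1 c a' b2 c' n Gs Qs] S3_D(2,3)[OF Q] by (auto simp: E1_Qs)
    have V: "b1 \<in> {1..n}" "b2 \<in> {1..n}" using padj_V[OF dg h(5)] padj_V[OF dg h(7)] by auto
    have anc: "anc Gs b1 b2" using h(12) Qs_ple V by blast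
    have n1: "\<not> ple Q b1 a" "\<not> ple Q b1 c"
      using h S1_padj(2)[OF Q1] E2_iff[of a b1 c n Gs Q] by auto
    define f where "f i = (if i = 0 then a else if i = 1 then b1 else c)" for i :: nat
    have "ple Q (f 1) b2"
    proof (rule run_below_nonconductor[OF Q1, where t = 1])
      show "padj Gs (f i) (f (Suc i))" if "i \<le> 1" for i
        using that h(5,6) padj_sym[of Gs b1 c] by (cases i) (auto simp: f_def)
    qed (use h n1 anc ple_refl[OF S1_padj(1)[OF Q1] V(1)] in \<open>auto simp: f_def\<close>)
    then have "ple Q b1 b2" by (simp add: f_def)
    then show "((a, b1, c), (a', b2, c')) \<in> E4 n Gs Q"
      using E4_iff[of a b1 c a' b2 c' n Gs Q] h S1_padj(2)[OF Q1] by simp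
  qed
qed

lemma S4_D:
  assumes "Q \<in> S4 n Gs"
  shows "Q \<in> S1 n Gs" "E2 n Gs Q = E2 n Gs Qs" "E3 n Gs Q = E3 n Gs Qs"
  using assms S3_D by (auto simp: S4_eq)

lemma Qs_S4: "Qs \<in> S4 n Gs" using Qs_S3 by (simp add: S4_eq)

lemma D_S1_iff:
  assumes "Q \<in> S1 n Gs" "1 \<le> t"
  shows "xs \<in> D n Gs t Q \<longleftrightarrow> length xs = t + 2 \<and> excl (padj Gs) (ple Q) (\<lambda>i. xs ! i) t"
  using D_iff_excl[OF S1_padj(1)[OF assms(1)] S1_padj(2)[OF assms(1)] assms(2)] .

lemma D_map_iff:
  assumes "Q \<in> S1 n Gs" "1 \<le> t"
  shows "map f [0..<t + 2] \<in> D n Gs t Q \<longleftrightarrow> excl (padj Gs) (ple Q) f t"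
proof -
  have "excl (padj Gs) (ple Q) (\<lambda>i. map f [0..<t + 2] ! i) t \<longleftrightarrow> excl (padj Gs) (ple Q) f t"
  proof (rule excl_cong)
    show "map f [0..<t + 2] ! i = f i" if "i \<le> Suc t" for i
      using that nth_map_upt[of i "t + 2" 0 f] by simp
  qed simp
  then show ?thesis using D_S1_iff[OF assms, of "map f [0..<t + 2]"] by simp
qed

lemma excl_V:
  assumes "excl (padj Gs) le f t" "i \<le> Suc t"
  shows "f i \<in> {1..n}"
proof (cases "i = Suc t")
  case True
  have "padj Gs (f t) (f (Suc t))" using assms unfolding excl_def by blast
  then show ?thesis using padj_V[OF dg] True by blast
next
  case False
  then have "padj Gs (f i) (f (Suc i))" using assms unfolding excl_def by auto
  then show ?thesis using padj_V[OF dg] by blast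
qed

lemma excl_Qs: "excl (padj Gs) (ple Qs) f t \<longleftrightarrow> excl (padj Gs) (anc Gs) f t"
proof -
  have "excl (padj Gs) (ple Qs) f t \<longleftrightarrow> excl (padj Gs) (anc Gs) f t"
    if V: "\<And>i. i \<le> Suc t \<Longrightarrow> f i \<in> {1..n}"
    by (rule excl_cong) (use Qs_ple[OF V V] in auto)
  then show ?thesis using excl_V by blast
qed

text \<open>On an itinerary that separates its endpoints, a sink run of interior vertices that fail to be
  ancestors of the conditioning set is itself mutually exclusive; if it were proper, the shorter
  itinerary would contradict the equality of the sets for smaller lengths.\<close>
lemma D_subset:
  assumes Q: "Q \<in> S1 n Gs" and t: "1 \<le> t"
    and smaller: "\<And>s. 1 \<le> s \<Longrightarrow> s < t \<Longrightarrow> D n Gs s Q = D n Gs s Qs"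
  shows "D n Gs t Q \<subseteq> D n Gs t Qs"
proof
  fix xs assume xs: "xs \<in> D n Gs t Q"
  define f where "f = (!) xs"
  have len: "length xs = t + 2" and ex: "excl (padj Gs) (ple Q) f t"
    using D_S1_iff[OF Q t, of xs] xs by (auto simp: f_def)
  have inj: "inj_on f {..Suc t}" and path: "\<And>i. i \<le> t \<Longrightarrow> padj Gs (f i) (f (Suc i))"
    and unc: "\<And>i j. Suc i < j \<Longrightarrow> j \<le> Suc t \<Longrightarrow> \<not> padj Gs (f i) (f j)"
    and eqv: "\<And>i j. i \<in> {1..t} \<Longrightarrow> j \<in> {1..t} \<Longrightarrow> ple Q (f i) (f j)"
    and nle: "\<And>i. i \<in> {1..t} \<Longrightarrow> \<not> ple Q (f i) (f 0) \<and> \<not> ple Q (f i) (f (Suc t))"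
    using ex unfolding excl_def by blast+
  define Z where "Z = downset n Q {f 0, f (Suc t)} - {f 0, f (Suc t)}"
  define T where "T = Z \<union> {f 0, f (Suc t)}"
  have ne: "f 0 \<noteq> f (Suc t)" using inj_onD[OF inj, of 0 "Suc t"] by auto
  have nadj: "\<not> padj Gs (f 0) (f (Suc t))" using unc[of 0 "Suc t"] t by simp
  have notZ: "f i \<notin> Z" if "i \<in> {1..t}" for i using nle[OF that] by (auto simp: Z_def downset_def)
  have "\<exists>i\<in>{1..t}. f i \<notin> anset Gs T"
  proof (rule ccontr)
    assume all: "\<not> ?thesis"
    have "dconn Gs (f 0) (f (Suc t)) Z"
    proof (rule path_dconn[where f = f and t = t, OF path])
      show "f i \<in> anset Gs (Z \<union> {f 0, f (Suc t)}) - Z" if "i \<in> {1..t}" for i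
        using all that notZ[OF that] by (auto simp: T_def)
    qed (use ne in \<open>auto simp: Z_def\<close>)
    then show False
      using not_padj_dsep[OF Q excl_V[OF ex, of 0] excl_V[OF ex, of "Suc t"] ne nadj] by (simp add: Z_def)
  qed
  then obtain i where "i \<in> {1..t}" "f i \<notin> anset Gs T" by blast
  then have i: "i \<le> Suc t" "f i \<notin> anset Gs T" by auto
  have ends: "f 0 \<in> anset Gs T" "f (Suc t) \<in> anset Gs T" using anset_self[of T Gs] by (auto simp: T_def)
  obtain k l where kl: "k \<le> l" "l < Suc t" "\<And>i. i \<in> {k..l} \<Longrightarrow> f i \<notin> anset Gs T"
    "\<And>i j. i \<in> {k..l} \<Longrightarrow> j \<in> {k..l} \<Longrightarrow> anc Gs (f i) (f j)"
    "\<And>i. i \<in> {k..l} \<Longrightarrow> \<not> anc Gs (f i) (f (Suc l))"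
    "\<And>i. i \<in> {k..l} \<Longrightarrow> k > 0 \<Longrightarrow> \<not> anc Gs (f i) (f (k - 1))"
    by (rule anc_sink_run[where f = f, OF ends(2) i]) (rule that)
  have k0: "0 < k" using kl(1) kl(3)[of 0] ends(1) by (cases k) auto
  let ?g = "\<lambda>i. f (k - 1 + i)" and ?s = "Suc l - k"
  have "excl (padj Gs) (anc Gs) ?g ?s"
    using kl(2) k0 by (intro excl_run[where p = "Suc t"] kl inj path unc) simp_all
  then have exs: "excl (padj Gs) (ple Qs) ?g ?s" by (simp add: excl_Qs)
  have s: "1 \<le> ?s" using kl(1) by simp
  show "xs \<in> D n Gs t Qs"
  proof (cases "?s < t")
    case False
    then have "k = 1" "?s = t" using kl(1,2) k0 by auto
    then have "excl (padj Gs) (ple Qs) f t" using exs by simp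
    then show ?thesis using D_S1_iff[OF Qs_S1 t, of xs] len by (simp add: f_def)
  next
    case True
    have "excl (padj Gs) (ple Q) ?g ?s"
      using exs D_map_iff[OF Qs_S1 s] D_map_iff[OF Q s] smaller[OF s True] by blast
    from excl_exit[OF this] have nk: "\<not> ple Q (f k) (f (k - 1))" "\<not> ple Q (f k) (f (Suc l))"
      using k0 kl(1) by auto
    have "k \<in> {1..t}" using k0 kl(1,2) by simp
    \<comment> \<open>A proper subrun has a neighbour among the interior vertices, which
      \<open>Q\<close> puts into the same block.\<close>
    moreover have "k - 1 \<in> {1..t} \<or> Suc l \<in> {1..t}" using True k0 kl(1,2) by auto
    ultimately show ?thesis using eqv[of k "k - 1"] eqv[of k "Suc l"] nk by blast
  qed
qed

text \<open>No stage maximises \<open>D\<close> for length 1. The missing inclusion comes from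
  \<open>E2\<close>, whose complement among the unshielded triples is \<open>D\<close> for
  \<open>t = 1\<close>.\<close>

lemma D1_eq:
  assumes Q: "Q \<in> S4 n Gs" shows "D n Gs 1 Q = D n Gs 1 Qs"
proof
  show "D n Gs 1 Q \<subseteq> D n Gs 1 Qs" by (rule D_subset[OF S4_D(1)[OF Q]]) auto
  note Q1 = S4_D(1)[OF Q]
  show "D n Gs 1 Qs \<subseteq> D n Gs 1 Q"
  proof
    fix xs assume xs: "xs \<in> D n Gs 1 Qs"
    define f where "f = (!) xs"
    have len: "length xs = 3" and ex: "excl (padj Gs) (ple Qs) f 1"
      using D_S1_iff[OF Qs_S1, of 1 xs] xs by (auto simp: f_def)
    have inj: "inj_on f {..2}" and path: "padj Gs (f 0) (f 1)" "padj Gs (f 1) (f 2)"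
      and na: "\<not> padj Gs (f 0) (f 2)" and nle: "\<not> ple Qs (f 1) (f 0)" "\<not> ple Qs (f 1) (f 2)"
      using ex unfolding excl_def by (auto simp: numeral_2_eq_2)
    have dist: "distinct [f 0, f 1, f 2]"
      using inj_onD[OF inj, of 0 1] inj_onD[OF inj, of 0 2] inj_onD[OF inj, of 1 2] by auto
    have "(f 0, f 1, f 2) \<notin> E2 n Gs Q" unfolding S4_D(2)[OF Q] E2_iff using nle by blast
    then have "\<not> ple Q (f 1) (f 0)" "\<not> ple Q (f 1) (f 2)"
      using dist path na padj_sym[of Gs "f 1" "f 2"] by (auto simp: E2_iff S1_padj(2)[OF Q1])
    moreover have "ple Q (f 1) (f 1)" using ple_refl[OF S1_padj(1)[OF Q1]] padj_V[OF dg path(1)] by blast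
    ultimately have "excl (padj Gs) (ple Q) f 1"
      using ex unfolding excl_def by (auto simp: numeral_2_eq_2)
    then show "xs \<in> D n Gs 1 Q" using D_S1_iff[OF Q1, of 1 xs] len by (simp add: f_def)
  qed
qed

lemma S5_eq: "S5 n Gs (Suc k) = {Q \<in> S4 n Gs. \<forall>s\<in>{1..Suc k}. D n Gs s Q = D n Gs s Qs}"
proof (induction k)
  case 0
  then show ?case using D1_eq by auto
next
  case (Suc k)
  have "S5 n Gs (Suc (Suc k)) = {Q \<in> S5 n Gs (Suc k). D n Gs (Suc (Suc k)) Q = D n Gs (Suc (Suc k)) Qs}"
    unfolding S5.simps(3)
  proof (rule argmax_on_card)
    show "finite (D n Gs (Suc (Suc k)) Qs)" by (rule finite_D)
    show "Qs \<in> S5 n Gs (Suc k)" unfolding Suc using Qs_S4 by simp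
    fix Q assume "Q \<in> S5 n Gs (Suc k)"
    then have Q: "Q \<in> S4 n Gs" "\<forall>s\<in>{1..Suc k}. D n Gs s Q = D n Gs s Qs" unfolding Suc by auto
    show "D n Gs (Suc (Suc k)) Q \<subseteq> D n Gs (Suc (Suc k)) Qs"
      by (rule D_subset[OF S4_D(1)[OF Q(1)]]) (use Q(2) in auto)
  qed
  moreover have "{1..Suc (Suc k)} = insert (Suc (Suc k)) {1..Suc k}" by auto
  ultimately show ?case unfolding Suc by (simp del: atLeastAtMost_iff S5.simps) blast
qed

lemma S5_last: "S5 n Gs (n - 2) = {Q \<in> S4 n Gs. \<forall>s\<in>{1..n - 2}. D n Gs s Q = D n Gs s Qs}"
proof -
  have "n - 2 = Suc (n - 3)" using n3 by simp
  then show ?thesis using S5_eq[of "n - 3"] by simp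
qed

lemma S6_eq: "S6 n Gs = {Q \<in> S5 n Gs (n - 2). E6 n Gs Q = E6 n Gs Qs}"
  unfolding S6_def
proof (rule argmin_on_card[OF _ _ finite_E6])
  show "Qs \<in> S5 n Gs (n - 2)" unfolding S5_last using Qs_S4 by simp
  fix Q assume "Q \<in> S5 n Gs (n - 2)"
  then have Q: "Q \<in> S4 n Gs" "\<And>s. s \<in> {1..n - 2} \<Longrightarrow> D n Gs s Q = D n Gs s Qs" unfolding S5_last by auto
  note Q1 = S4_D(1)[OF Q(1)]
  show "E6 n Gs Qs \<subseteq> E6 n Gs Q"
  proof clarify
    fix xs a b c assume "(xs, (a, b, c)) \<in> E6 n Gs Qs"
    then obtain t where t: "t \<in> {1..n - 2}" and h: "a = xs ! 0" "c = xs ! (t + 1)"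
      "distinct [a, b, c]" "padj Gs a b" "padj Gs c b" "(a, b, c) \<notin> E2 n Gs Q \<union> E3 n Gs Q"
      "xs \<in> D n Gs t Qs" "ple Qs (xs ! 1) b"
      using E6_iff[of xs a b c n Gs Qs] S4_D(2,3)[OF Q(1)] by (auto simp: E1_Qs)
    have xs: "xs \<in> D n Gs t Q" using h(7) Q(2)[OF t] by simp
    define f where "f = (!) xs"
    have t1: "1 \<le> t" using t by simp
    have exs: "excl (padj Gs) (anc Gs) f t"
      using D_S1_iff[OF Qs_S1 t1, of xs] h(7) excl_Qs by (auto simp: f_def)
    have ex: "excl (padj Gs) (ple Q) f t" using D_S1_iff[OF Q1 t1, of xs] xs by (auto simp: f_def)
    have "b \<in> {1..n}" "f 1 \<in> {1..n}" using padj_V[OF dg h(4)] excl_V[OF ex, of 1] by auto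
    then have fb: "anc Gs (f 1) b" using h(8) Qs_ple by (simp add: f_def)
    have "ple Q (f 1) b"
    proof (rule run_below_nonconductor[OF Q1, where t = t])
      show "padj Gs (f i) (f (Suc i))" if "i \<le> t" for i using that ex unfolding excl_def by blast
      show "ple Q (f 1) (f i)" if "i \<in> {1..t}" for i using that ex t1 unfolding excl_def by auto
      show "\<not> ple Q (f i) (f 0) \<and> \<not> ple Q (f i) (f (Suc t))" if "i \<in> {1..t}" for i
        using that ex unfolding excl_def by blast
      show "anc Gs (f i) b" if "i \<in> {1..t}" for i
      proof -
        have "anc Gs (f i) (f 1)" using that exs t1 unfolding excl_def by auto
        then show ?thesis using fb by (rule anc_trans)
      qed
      show "\<not> padj Gs (f 0) (f (Suc t))" using ex t1 unfolding excl_def by auto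
    qed (use h t1 in \<open>auto simp: f_def\<close>)
    then show "(xs, (a, b, c)) \<in> E6 n Gs Q"
      using E6_iff[of xs a b c n Gs Q] t h xs S1_padj(2)[OF Q1] by (auto simp: f_def)
  qed
qed

lemma S6_D:
  assumes "Q \<in> S6 n Gs"
  shows "Q \<in> S4 n Gs" "s \<in> {1..n - 2} \<Longrightarrow> D n Gs s Q = D n Gs s Qs" "E6 n Gs Q = E6 n Gs Qs"
  using assms by (auto simp: S6_eq S5_last)

text \<open>Treats a given graph with its minimiser and \<open>Gs\<close> with \<open>Qs\<close> as
  instances of one notion, so that their roles can be exchanged.\<close>

definition represents :: "popart \<Rightarrow> (nat \<times> nat) set \<Rightarrow> bool" where
  "represents Q G \<longleftrightarrow> Q \<in> S6 n Gs \<and> padj G = padj Gs \<and>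
     (\<forall>a\<in>{1..n}. \<forall>b\<in>{1..n}. anc G a b \<longleftrightarrow> ple Q a b) \<and>
     (\<forall>a b c. perf G a b c \<longleftrightarrow> perf Gs a b c)"

lemma Qs_represents: "represents Qs Gs"
  unfolding represents_def using Qs_ple Qs_S4 by (simp add: S6_eq S5_last)

lemma represents_excl:
  assumes "represents Q G"
  shows "excl (padj G) (anc G) f t \<longleftrightarrow> excl (padj Gs) (anc Gs) f t"
proof -
  have Q: "Q \<in> S6 n Gs" and padj: "padj G = padj Gs"
    and anc: "\<And>a b. a \<in> {1..n} \<Longrightarrow> b \<in> {1..n} \<Longrightarrow> anc G a b = ple Q a b"
    using assms unfolding represents_def by blast+
  note Q1 = S4_D(1)[OF S6_D(1)[OF Q]]
  have "excl (padj Gs) (anc G) f t \<longleftrightarrow> excl (padj Gs) (ple Q) f t"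
    if V: "\<And>i. i \<le> Suc t \<Longrightarrow> f i \<in> {1..n}"
    by (rule excl_cong) (use anc[OF V V] in auto)
  then have "excl (padj Gs) (anc G) f t \<longleftrightarrow> excl (padj Gs) (ple Q) f t" using excl_V by blast
  also have "\<dots> \<longleftrightarrow> excl (padj Gs) (ple Qs) f t"
  proof (cases "t \<in> {1..n - 2}")
    case True
    then have t: "1 \<le> t" by simp
    show ?thesis using D_map_iff[OF Q1 t] D_map_iff[OF Qs_S1 t] S6_D(2)[OF Q True] by simp
  next
    case False
    \<comment> \<open>\<open>t = 0\<close> is excluded by \<open>excl\<close>, and
      \<open>t > n - 2\<close> would require more than \<open>n\<close> distinct vertices.\<close>
    have "\<not> excl (padj Gs) le f t" for le
    proof
      assume ex: "excl (padj Gs) le f t"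
      then have "inj_on f {..Suc t}" "1 \<le> t" unfolding excl_def by auto
      moreover have "f ` {..Suc t} \<subseteq> {1..n}" using excl_V[OF ex] by auto
      ultimately have "card {..Suc t} \<le> card {1..n}" by (intro card_inj_on_le[of f]) auto
      then show False using False \<open>1 \<le> t\<close> by simp
    qed
    then show ?thesis by blast
  qed
  also have "\<dots> \<longleftrightarrow> excl (padj Gs) (anc Gs) f t" by (rule excl_Qs)
  finally show ?thesis by (simp add: padj)
qed

text \<open>The right-hand side mentions neither \<open>Q\<close> nor \<open>G\<close>, so it links
  the ancestries of any two represented graphs.\<close>

lemma represents_E6:
  assumes rep: "represents Q G" and ex: "excl (padj Gs) (anc Gs) f t"
    and y: "padj Gs (f 0) y" "padj Gs (f (Suc t)) y" "\<not> perf Gs (f 0) y (f (Suc t))"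
      "\<not> anc G y (f 0)" "\<not> anc G y (f (Suc t))"
  shows "anc G (f 1) y \<longleftrightarrow> (map f [0..<t + 2], (f 0, y, f (Suc t))) \<in> E6 n Gs Qs"
proof -
  have Q: "Q \<in> S6 n Gs"
    and anc: "\<And>a b. a \<in> {1..n} \<Longrightarrow> b \<in> {1..n} \<Longrightarrow> anc G a b = ple Q a b"
    using rep unfolding represents_def by blast+
  note Q4 = S6_D(1)[OF Q]
  note Q1 = S4_D(1)[OF Q4]
  have V: "f 0 \<in> {1..n}" "f 1 \<in> {1..n}" "f (Suc t) \<in> {1..n}" "y \<in> {1..n}"
    using excl_V[OF ex, of 0] excl_V[OF ex, of 1] excl_V[OF ex, of "Suc t"] padj_V[OF dg y(1)] by auto
  have t1: "1 \<le> t" and inj: "inj_on f {..Suc t}" using ex unfolding excl_def by auto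
  have "card {..Suc t} \<le> card {1..n}"
    using excl_V[OF ex] by (intro card_inj_on_le[OF inj]) auto
  then have t: "t \<in> {1..n - 2}" using t1 by simp
  have ne: "f 0 \<noteq> f (Suc t)" using inj_onD[OF inj, of 0 "Suc t"] by auto
  have dist: "distinct [f 0, y, f (Suc t)]" using ne y by (auto simp: padj_def)
  define xs where "xs = map f [0..<t + 2]"
  have nth: "xs ! i = f i" if "i \<le> Suc t" for i
    using that nth_map_upt[of i "t + 2" 0 f] by (simp add: xs_def)
  have len: "length xs = t + 2" by (simp add: xs_def)
  have "xs \<in> D n Gs t Qs" using D_map_iff[OF Qs_S1 t1, of f] ex excl_Qs by (simp add: xs_def)
  then have xsD: "xs \<in> D n Gs t Q" using S6_D(2)[OF Q t] by simp
  have n2: "(f 0, y, f (Suc t)) \<notin> E2 n Gs Q" using y(4,5) anc V by (simp add: E2_iff)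
  have n3: "(f 0, y, f (Suc t)) \<notin> E3 n Gs Q" using y(3) S4_D(3)[OF Q4] E3_Qs by simp
  have "anc G (f 1) y \<longleftrightarrow> ple Q (f 1) y" using anc V by simp
  also have "\<dots> \<longleftrightarrow> (xs, (f 0, y, f (Suc t))) \<in> E6 n Gs Q"
  proof
    assume "ple Q (f 1) y"
    then show "(xs, (f 0, y, f (Suc t))) \<in> E6 n Gs Q"
      unfolding E6_iff using t1 dist y S1_padj(2)[OF Q1] n2 n3 xsD
      by (intro bexI[OF _ t]) (simp add: nth)
  next
    assume "(xs, (f 0, y, f (Suc t))) \<in> E6 n Gs Q"
    then show "ple Q (f 1) y" unfolding E6_iff using nth[of 1] by auto
  qed
  also have "\<dots> \<longleftrightarrow> (xs, (f 0, y, f (Suc t))) \<in> E6 n Gs Qs" using S6_D(3)[OF Q] by simp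
  finally show ?thesis by (simp add: xs_def)
qed

lemma represents_similar:
  assumes r1: "represents Q1 G1" and r2: "represents Q2 G2"
  shows "similar_pair G1 G2"
proof
  have p: "padj G1 = padj Gs" "padj G2 = padj Gs" and q: "perf G1 = perf Gs" "perf G2 = perf Gs"
    using r1 r2 unfolding represents_def by (auto simp: fun_eq_iff)
  show "padj G1 = padj G2" "perf G1 = perf G2" using p q by simp_all
  show ex: "excl (padj G1) (anc G1) f t \<longleftrightarrow> excl (padj G2) (anc G2) f t" for f t
    using represents_excl[OF r1] represents_excl[OF r2] by simp
  show "anc G2 (f 1) y"
    if h: "excl (padj G1) (anc G1) f t" "padj G1 (f 0) y" "padj G1 (f (Suc t)) y"
      "\<not> perf G1 (f 0) y (f (Suc t))" "\<not> anc G1 y (f 0)" "\<not> anc G1 y (f (Suc t))" "anc G1 (f 1) y" for f t y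
  proof -
    have e: "excl (padj Gs) (anc Gs) f t" using h(1) represents_excl[OF r1] by simp
    have ne: "f 0 \<noteq> f (Suc t)" "\<not> padj Gs (f 0) (f (Suc t))"
      using e unfolding excl_def by (auto dest: inj_onD)
    \<comment> \<open>\<open>represents_E6\<close> for \<open>G2\<close> needs that \<open>y\<close>
      reaches neither endpoint in \<open>G2\<close>; this is transferred from \<open>G1\<close> by
      the triple as an \<open>excl\<close> witness with \<open>t = 1\<close>.\<close>
    define g where "g i = (if i = 0 then f 0 else if i = 1 then y else f (Suc t))" for i :: nat
    have "y \<noteq> f 0" "y \<noteq> f (Suc t)" using h(2,3) by (auto simp: padj_def)
    then have "inj_on g {..Suc 1}" using ne(1) by (auto simp: g_def inj_on_def)
    moreover have "\<not> padj G1 (g i) (g j)" if "Suc i < j" "j \<le> Suc 1" for i j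
      using that ne(2) p(1) by (auto simp: g_def)
    moreover have "padj G1 (g i) (g (Suc i))" if "i \<le> 1" for i
      using that h(2,3) padj_sym[of G1 y] by (cases i) (auto simp: g_def)
    ultimately have "excl (padj G1) (anc G1) g 1"
      using h(5,6) unfolding excl_def by (auto simp: g_def)
    then have "excl (padj G2) (anc G2) g 1" using ex by simp
    from excl_exit[OF this] have n2: "\<not> anc G2 y (f 0)" "\<not> anc G2 y (f (Suc t))" by (auto simp: g_def)
    show ?thesis
      using represents_E6[OF r1 e, of y] represents_E6[OF r2 e, of y] h n2 p q by simp
  qed
qed

lemma props_represents:
  assumes Q: "Q \<in> S6 n Gs" and E: "digraph n E" and pr: "props n Gs Q E"
  shows "represents Q E"
proof -
  note Q4 = S6_D(1)[OF Q]
  note Q1 = S4_D(1)[OF Q4]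
  note SS = S1_padj(1)[OF Q1]
  obtain P \<pi> where PQ: "Q = (P, \<pi>)" by (cases Q)
  have p1: "padj E a b \<longleftrightarrow> (a, b) \<in> E1 n Gs Q" if "a \<in> {1..n}" "b \<in> {1..n}" for a b
    using pr that unfolding props_def PQ by simp
  have p2: "anc E a b \<longleftrightarrow> ple Q a b" if "a \<in> {1..n}" "b \<in> {1..n}" for a b
    using pr that unfolding props_def PQ ple_def by simp
  have p3: "\<exists>d\<in>blk P b. (a, d) \<in> E \<and> (c, d) \<in> E"
    if "(a, b, c) \<in> E3 n Gs Q" "\<forall>b'\<in>{1..n}. (blk P b', blk P b) \<in> \<pi> \<and> blk P b' \<noteq> blk P b \<longrightarrow> (a, b', c) \<notin> E3 n Gs Q"
    for a b c
    using pr that unfolding props_def PQ by simp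
  have p4: "\<not> (\<exists>d\<in>blk P b. (a, d) \<in> E \<and> (c, d) \<in> E)"
    if "a \<in> {1..n}" "b \<in> {1..n}" "c \<in> {1..n}" "distinct [a, b, c]"
       "(a, b) \<in> E1 n Gs Q" "(c, b) \<in> E1 n Gs Q" "(a, c) \<notin> E1 n Gs Q"
       "\<not> le_max \<pi> (blk P b) {blk P a, blk P c}" "(a, b, c) \<notin> E3 n Gs Q" for a b c
    using pr that unfolding props_def PQ by simp
  have padj: "padj E a b \<longleftrightarrow> padj Gs a b" for a b
    using p1[of a b] S1_padj(2)[OF Q1, of a b] padj_V[OF E, of a b] padj_V[OF dg, of a b] by blast
  have E3: "(a, b, c) \<in> E3 n Gs Q \<longleftrightarrow> perf Gs a b c" for a b c
    using S4_D(3)[OF Q4] E3_Qs by simp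
  have "perf E a b c" if abc: "perf Gs a b c" for a b c
  proof -
    \<comment> \<open>Property (3) yields a common child only at a minimal block, so it is applied
      to an \<open>m\<close> below \<open>b\<close> that is minimal in \<open>B\<close>;
      \<open>U\<close> counts the vertices below and thus measures minimality.\<close>
    define B where "B = {x \<in> {1..n}. ple Q x b \<and> perf Gs a x c}"
    have bV: "b \<in> {1..n}" using abc padj_V[OF dg] unfolding perf_def by blast
    then have bB: "b \<in> B" using abc ple_refl[OF SS bV] by (simp add: B_def)
    define U where "U x = card {y \<in> {1..n}. ple Q y x}" for x
    obtain m where m: "m \<in> B" "\<And>x. x \<in> B \<Longrightarrow> U m \<le> U x"
      using ex_has_least_nat[of "\<lambda>x. x \<in> B" b U, OF bB] by blast
    have mV: "m \<in> {1..n}" and mb: "ple Q m b" and pm: "perf Gs a m c" using m(1) by (auto simp: B_def)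
    have "(a, b', c) \<notin> E3 n Gs Q"
      if b': "b' \<in> {1..n}" "(blk P b', blk P m) \<in> \<pi>" "blk P b' \<noteq> blk P m" for b'
    proof
      assume "(a, b', c) \<in> E3 n Gs Q"
      then have "perf Gs a b' c" by (simp add: E3)
      have le: "ple Q b' m" using b'(2) by (simp add: ple_def PQ)
      have nle: "\<not> ple Q m b'" using blk_eq_iff[OF SS b'(1), of m] le b'(3) by (simp add: PQ)
      have "b' \<in> B" using b'(1) \<open>perf Gs a b' c\<close> ple_trans[OF SS le mb] by (simp add: B_def)
      then have "U m \<le> U b'" by (rule m(2))
      moreover have "{y \<in> {1..n}. ple Q y b'} \<subset> {y \<in> {1..n}. ple Q y m}"
      proof (rule psubsetI)
        show "{y \<in> {1..n}. ple Q y b'} \<subseteq> {y \<in> {1..n}. ple Q y m}" using ple_trans[OF SS _ le] by blast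
        show "{y \<in> {1..n}. ple Q y b'} \<noteq> {y \<in> {1..n}. ple Q y m}" using nle ple_refl[OF SS mV] mV by blast
      qed
      then have "U b' < U m" unfolding U_def by (intro psubset_card_mono) auto
      ultimately show False by simp
    qed
    then obtain d where d: "d \<in> blk P m" "(a, d) \<in> E" "(c, d) \<in> E" using p3[of a m c] pm E3 by blast
    have dV: "d \<in> {1..n}" and "ple Q d m" using mem_blk_iff[OF SS mV, of d] d(1) by (auto simp: PQ)
    from this(2) have "ple Q d b" by (rule ple_trans[OF SS _ mb])
    then have "anc E d b" using p2[OF dV bV] by simp
    then show ?thesis using abc d unfolding perf_def padj by blast
  qed
  moreover have "perf Gs a b c" if abc: "perf E a b c" for a b c
  proof -
    obtain d where d: "(a, d) \<in> E" "(c, d) \<in> E" "anc E d b"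
      and h: "a \<noteq> c" "\<not> padj Gs a c" "padj Gs a b" "padj Gs c b"
      using abc unfolding perf_def padj by blast
    have ad: "padj Gs a d" "padj Gs c d" using common_child_padj[OF E d(1,2)] padj by blast+
    have V: "a \<in> {1..n}" "b \<in> {1..n}" "c \<in> {1..n}" "d \<in> {1..n}"
      using padj_V[OF dg h(3)] padj_V[OF dg ad(2)] by auto
    have pd: "perf E a d c" using h ad d unfolding perf_def padj using anc_refl by blast
    have "\<not> ple Q d a" "\<not> ple Q d c" using perf_not_anc[OF pd] p2 V by blast+
    then have nle: "\<not> le_max \<pi> (blk P d) {blk P a, blk P c}" by (simp add: le_max_def ple_def PQ)
    have dist: "distinct [a, d, c]" using h(1) ad by (auto simp: padj_def)
    have "d \<in> blk P d" using mem_blk_iff[OF SS V(4), of d] ple_refl[OF SS V(4)] V(4) by (simp add: PQ)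
    \<comment> \<open>Contrapositive of property (4) at the block of the common child
      \<open>d\<close> itself. Since \<open>d\<close> lies below \<open>b\<close>, it is also
      conditioned on for the triple with \<open>b\<close>, which carries the membership over to
      \<open>b\<close>.\<close>
    then have "(a, d, c) \<in> E3 n Gs Q"
      using p4[OF V(1,4,3) dist _ _ _ nle] S1_padj(2)[OF Q1] ad h(2) d(1,2) by blast
    then have "perf Gs a d c" by (simp add: E3)
    moreover have "d \<in> downset n Q {a, b, c} - {a, c}"
      using p2[OF V(4,2)] d(3) V(4) dist by (auto simp: downset_def)
    ultimately have "dconn Gs a c (downset n Q {a, b, c} - {a, c})" by (rule perf_dconn) auto
    moreover have "distinct [a, b, c]" using h by (auto simp: padj_def)
    ultimately have "(a, b, c) \<in> E3 n Gs Q" using E3_S1_iff[OF Q1] h by blast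
    then show ?thesis by (simp add: E3)
  qed
  ultimately show ?thesis using Q padj p2 unfolding represents_def by (auto simp: fun_eq_iff)
qed

text \<open>For property (3), the common child behind a triple forms such a triple itself and lies
  below \<open>b\<close>, so minimality places it in the block of \<open>b\<close>. For (4), a
  common child in the block of \<open>b\<close> reaches \<open>b\<close> and would make the triple
  perfect.\<close>

lemma Qs_props: "props n Gs Qs Gs"
proof -
  define P \<pi> where "P = scc_part n Gs" and "\<pi> = scc_order n Gs"
  have PQ: "Qs = (P, \<pi>)" by (simp add: Qs_def P_def \<pi>_def)
  have mem: "d \<in> blk P a \<longleftrightarrow> d \<in> {1..n} \<and> anc Gs d a \<and> anc Gs a d" if "a \<in> {1..n}" for a d
    using mem_blk_iff[OF Qs_SS that, of d] Qs_ple[OF that, of d] Qs_ple[OF _ that, of d] by (auto simp: PQ)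
  have "\<exists>d\<in>blk P b. (a, d) \<in> Gs \<and> (c, d) \<in> Gs"
    if abc: "(a, b, c) \<in> E3 n Gs Qs"
      and min: "\<forall>b'\<in>{1..n}. (blk P b', blk P b) \<in> \<pi> \<and> blk P b' \<noteq> blk P b \<longrightarrow> (a, b', c) \<notin> E3 n Gs Qs"
    for a b c
  proof -
    have p: "perf Gs a b c" using abc by (simp add: E3_Qs)
    obtain d where d: "(a, d) \<in> Gs" "(c, d) \<in> Gs" "anc Gs d b"
      and h: "a \<noteq> c" "\<not> padj Gs a c" "padj Gs a b" using p unfolding perf_def by blast
    have ad: "padj Gs a d" "padj Gs c d" by (rule common_child_padj[OF dg d(1,2)])+
    have V: "b \<in> {1..n}" "d \<in> {1..n}" using padj_V[OF dg h(3)] padj_V[OF dg ad(2)] by auto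
    have "perf Gs a d c" using h ad d unfolding perf_def using anc_refl by blast
    then have "(a, d, c) \<in> E3 n Gs Qs" by (simp add: E3_Qs)
    moreover have "(blk P d, blk P b) \<in> \<pi>" using Qs_ple[OF V(2,1)] d(3) by (simp add: ple_def PQ)
    ultimately have "blk P d = blk P b" using min V(2) by blast
    then have "d \<in> blk P b" using mem[OF V(2), of d] V(2) by auto
    then show ?thesis using d by blast
  qed
  moreover have "\<not> (\<exists>d\<in>blk P b. (a, d) \<in> Gs \<and> (c, d) \<in> Gs)"
    if V: "b \<in> {1..n}" and h: "distinct [a, b, c]" "padj Gs a b" "padj Gs c b" "\<not> padj Gs a c"
      "(a, b, c) \<notin> E3 n Gs Qs" for a b c
  proof
    assume "\<exists>d\<in>blk P b. (a, d) \<in> Gs \<and> (c, d) \<in> Gs"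
    then obtain d where "d \<in> blk P b" "(a, d) \<in> Gs" "(c, d) \<in> Gs" by blast
    then have "perf Gs a b c" using h mem[OF V, of d] unfolding perf_def by auto
    then show False using h(5) by (simp add: E3_Qs)
  qed
  moreover have "anc Gs a b \<longleftrightarrow> (blk P a, blk P b) \<in> \<pi>" if "a \<in> {1..n}" "b \<in> {1..n}" for a b
    using Qs_ple[OF that] by (simp add: ple_def PQ)
  ultimately show ?thesis unfolding props_def PQ prod.case E1_Qs[unfolded PQ] by blast
qed

end

theorem theorem4p1:
  fixes n :: nat and Gs :: "(nat \<times> nat) set"
  assumes "n \<ge> 3" and "digraph n Gs"
  shows "(\<forall>Q E. Q \<in> S6 n Gs \<and> digraph n E \<and> props n Gs Q E \<longrightarrow> markov_equiv n E Gs)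
         \<and> props n Gs (scc_part n Gs, scc_order n Gs) Gs"
proof -
  interpret true_graph n Gs using assms by unfold_locales
  have "markov_equiv n E Gs" if h: "Q \<in> S6 n Gs" "digraph n E" "props n Gs Q E" for Q E
  proof -
    have rep: "represents Q E" by (rule props_represents[OF h])
    have "dconn E a b Z \<longleftrightarrow> dconn Gs a b Z" if "a \<noteq> b" "a \<notin> Z" "b \<notin> Z" for a b Z
      using similar_pair.dconn_transfer[OF represents_similar[OF rep Qs_represents] that]
        similar_pair.dconn_transfer[OF represents_similar[OF Qs_represents rep] that] by blast
    then show ?thesis unfolding markov_equiv_def dsep_def by blast
  qed
  then show ?thesis using Qs_props unfolding Qs_def by blast
qed

end
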